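(* Let $(M,L)$ be a Riemannian space of dimension $n\ge3$ and let $\overline L=f(e^{\sigma}L,\beta)$ be a generalized $\beta$-conformal change. Put $$\alpha_1=\frac{e^{\sigma}p_{-1}}{2}-\frac{e^{\sigma}p\lambda}{n+1},\qquad \alpha_2=\frac{p_{02}}{6}-\frac{q_0\lambda}{n+1}.$$ Then the following assertions are equivalent: (a) $\alpha_1=0$ and $\alpha_2=0$; (b) $(M,\overline L)$ is C-reducible; (c) $(M,\overline L)$ is either of Randers type or of Kropina type.
   Context: $(M,L)$ is an $n$-dimensional smooth Finsler manifold (Riemannian when $g_{ij}$ does not depend on $y$); $\dot\partial_i=\partial/\partial y^i$, $g_{ij}=\frac12\dot\partial_i\dot\partial_jL^2$, $l_i=\dot\partial_iL$, $y_i=g_{ij}y^j$, $h_{ij}=g_{ij}-l_il_j$, $C_{ijk}=\frac12\dot\partial_kg_{ij}$, $C_i=C_{ijk}g^{jk}$. A generalized $\beta$-conformal change is $L\mapsto\overline{L}=f(\widetilde L,\beta)$ with $\widetilde L=e^{\sigma(x)}L$, $\sigma$ a smooth function on $M$, $\beta=b_i(x)y^i$ a 1-form, and $f$ smooth on a connected conical domain and positively homogeneous of degree one in $(\widetilde L,\beta)$; it is assumed that $(M,\overline L)$ is a Finsler space. Barred objects are those of $(M,\overline L)$. Subscripts $1,2$ on $f$ denote partial derivatives with respect to $\widetilde L,\beta$. Put $p=ff_1/L$, $q_0=ff_{22}$, $p_0=f_2^2+q_0$, $p_{-1}=ff_{12}/L+pf_2/f$, $p_{02}=\partial p_0/\partial\beta$,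 $m_i=b_i-(\beta/L^2)y_i$, $m^2=g^{ij}m_im_j$, $$s_0=\frac{e^{-\sigma}q_0}{p(e^{\sigma}p+m^2q_0)},\qquad \lambda=\frac{(n+1)p_{-1}}{2p}-\frac{3e^{\sigma}p_{-1}m^2s_0}{2}+\frac{p_{02}m^2}{2(e^{\sigma}p+q_0m^2)}.$$ Standing assumptions at the points under consideration: $m_i\ne0$, $m^2\neq0$, $p\ne0$, $e^{\sigma}p+m^2q_0\neq0$. Identities are understood at all attained values of $(\widetilde L,\beta)$. A Finsler space $(M,L)$ of dimension $n\ge3$ is C-reducible if $C_{ijk}=\frac{1}{n+1}(h_{ij}C_k+h_{ki}C_j+h_{jk}C_i)$. Here "$(M,\overline L)$ is of Randers type" means that, for constants $c_i$, either $f=c_2\widetilde L+c_1\beta$ or $f=c_0\sqrt{c_3\beta^2+c_4\widetilde L^2}+c_5\beta$ with $c_0,c_4\neq0$; "of Kropina type" means $f=c_6\widetilde L^2/\beta+c_7\beta$ with constants $c_6\neq0$, $c_7$. *)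

theory Defs
  imports "HOL-Analysis.Analysis"
begin

section \<open>Smooth maps between normed spaces\<close>

text \<open>Meant for open sets \<open>S\<close> in finite-dimensional spaces, where continuity of all iterated
  directional derivatives is the usual notion of class \<open>C\<^sup>k\<close>.\<close>

primrec Ck_on :: "nat \<Rightarrow> ('a::real_normed_vector \<Rightarrow> 'b::real_normed_vector) \<Rightarrow> 'a set \<Rightarrow> bool" where
  "Ck_on 0 f S \<longleftrightarrow> continuous_on S f"
| "Ck_on (Suc k) f S \<longleftrightarrow>
     (\<forall>x\<in>S. f differentiable at x) \<and> (\<forall>v. Ck_on k (\<lambda>x. frechet_derivative f (at x) v) S)"

definition smooth_on :: "'a::real_normed_vector set \<Rightarrow> ('a \<Rightarrow> 'b::real_normed_vector) \<Rightarrow> bool" where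
  "smooth_on S f \<longleftrightarrow> (\<forall>k. Ck_on k f S)"


section \<open>Smooth manifolds and tangent vectors\<close>

text \<open>A chart is a pair of its domain and its coordinate map; the dimension is \<open>CARD('n)\<close>.\<close>

type_synonym ('a, 'n) chart = "'a set \<times> ('a \<Rightarrow> real ^ 'n)"

abbreviation chart_inv :: "('a, 'n) chart \<Rightarrow> real ^ 'n \<Rightarrow> 'a" where
  "chart_inv c \<equiv> inv_into (fst c) (snd c)"

definition smooth_manifold :: "'a topology \<Rightarrow> ('a, 'n::finite) chart set \<Rightarrow> bool" where
  "smooth_manifold X \<A> \<longleftrightarrow>
     Hausdorff_space X \<and> second_countable X \<and>
     (\<Union>c\<in>\<A>. fst c) = topspace X \<and>
     (\<forall>c\<in>\<A>. openin X (fst c) \<and> open (snd c ` fst c) \<and>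
        homeomorphic_map (subtopology X (fst c)) (top_of_set (snd c ` fst c)) (snd c)) \<and>
     (\<forall>c\<in>\<A>. \<forall>d\<in>\<A>. smooth_on (snd c ` (fst c \<inter> fst d)) (snd d \<circ> chart_inv c))"

text \<open>A tangent vector at a point is the family of its component vectors in the charts around that
  point, related by the Jacobians of the coordinate changes (and 0 for all other pairs, so that
  equality of vectors is equality of functions).\<close>

type_synonym ('a, 'n) tvec = "('a, 'n) chart \<Rightarrow> real ^ 'n"

definition tangent_space :: "('a, 'n::finite) chart set \<Rightarrow> 'a \<Rightarrow> ('a, 'n) tvec set" where
  "tangent_space \<A> p = {v.
     (\<forall>c\<in>\<A>. \<forall>d\<in>\<A>. p \<in> fst c \<longrightarrow> p \<in> fst d \<longrightarrow>
        v d = frechet_derivative (snd d \<circ> chart_inv c) (at (snd c p)) (v c)) \<and>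
     (\<forall>c. \<not> (c \<in> \<A> \<and> p \<in> fst c) \<longrightarrow> v c = 0)}"

definition slit_tangent_bundle ::
  "'a topology \<Rightarrow> ('a, 'n::finite) chart set \<Rightarrow> ('a \<times> ('a, 'n) tvec) set" where
  "slit_tangent_bundle X \<A> = {(p, v). p \<in> topspace X \<and> v \<in> tangent_space \<A> p \<and> v \<noteq> (\<lambda>_. 0)}"

text \<open>The point \<open>(x, y)\<close> of the tangent bundle in the natural coordinates induced by a chart.\<close>

definition bundle_point ::
  "('a, 'n::finite) chart set \<Rightarrow> ('a, 'n) chart \<Rightarrow> real ^ 'n \<Rightarrow> real ^ 'n \<Rightarrow> 'a \<times> ('a, 'n) tvec" where
  "bundle_point \<A> c x y =
     (chart_inv c x, \<lambda>d. if d \<in> \<A> \<and> chart_inv c x \<in> fst d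
        then frechet_derivative (snd d \<circ> chart_inv c) (at x) y else 0)"

definition coord_set ::
  "('a, 'n::finite) chart set \<Rightarrow> ('a, 'n) chart \<Rightarrow> ('a \<times> ('a, 'n) tvec) set
     \<Rightarrow> ((real ^ 'n) \<times> (real ^ 'n)) set" where
  "coord_set \<A> c T = {(x, y). x \<in> snd c ` fst c \<and> bundle_point \<A> c x y \<in> T}"

definition local_rep ::
  "('a, 'n::finite) chart set \<Rightarrow> ('a, 'n) chart \<Rightarrow> ('a \<times> ('a, 'n) tvec \<Rightarrow> real)
     \<Rightarrow> real ^ 'n \<Rightarrow> real ^ 'n \<Rightarrow> real" where
  "local_rep \<A> c F x y = F (bundle_point \<A> c x y)"

definition smooth_scalar :: "('a, 'n::finite) chart set \<Rightarrow> ('a \<Rightarrow> real) \<Rightarrow> bool" where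
  "smooth_scalar \<A> \<sigma> \<longleftrightarrow> (\<forall>c\<in>\<A>. smooth_on (snd c ` fst c) (\<sigma> \<circ> chart_inv c))"

text \<open>A 1-form is regarded as a fibrewise linear function \<open>b\<^sub>i(x) y\<^sup>i\<close> on the tangent bundle.\<close>

definition form_components ::
  "('a, 'n::finite) chart set \<Rightarrow> ('a, 'n) chart \<Rightarrow> ('a \<times> ('a, 'n) tvec \<Rightarrow> real)
     \<Rightarrow> real ^ 'n \<Rightarrow> real ^ 'n" where
  "form_components \<A> c \<beta> x = (\<chi> i. local_rep \<A> c \<beta> x (axis i 1))"

definition one_form ::
  "('a, 'n::finite) chart set \<Rightarrow> ('a \<times> ('a, 'n) tvec \<Rightarrow> real) \<Rightarrow> bool" where
  "one_form \<A> \<beta> \<longleftrightarrow>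
     (\<forall>c\<in>\<A>. smooth_on (snd c ` fst c) (form_components \<A> c \<beta>) \<and>
        (\<forall>x\<in>snd c ` fst c. \<forall>y. local_rep \<A> c \<beta> x y = form_components \<A> c \<beta> x \<bullet> y))"


section \<open>Fibrewise Finsler tensors\<close>

text \<open>Here \<open>F\<close> is the restriction of a Finsler function to one tangent space, in the coordinates
  \<open>y\<^sup>i\<close>.\<close>

definition vpartial :: "'n::finite \<Rightarrow> (real ^ 'n \<Rightarrow> real) \<Rightarrow> real ^ 'n \<Rightarrow> real" where
  "vpartial i F y = deriv (\<lambda>t. F (y + t *\<^sub>R axis i 1)) 0"

definition fund_tensor :: "(real ^ 'n::finite \<Rightarrow> real) \<Rightarrow> real ^ 'n \<Rightarrow> real ^ 'n ^ 'n" where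
  "fund_tensor F y = (\<chi> i j. 1/2 * vpartial i (vpartial j (\<lambda>z. (F z)\<^sup>2)) y)"

definition fund_inverse :: "(real ^ 'n::finite \<Rightarrow> real) \<Rightarrow> real ^ 'n \<Rightarrow> real ^ 'n ^ 'n" where
  "fund_inverse F y = matrix_inv (fund_tensor F y)"

definition lower_y :: "(real ^ 'n::finite \<Rightarrow> real) \<Rightarrow> real ^ 'n \<Rightarrow> real ^ 'n" where
  "lower_y F y = fund_tensor F y *v y"

definition angular :: "(real ^ 'n::finite \<Rightarrow> real) \<Rightarrow> real ^ 'n \<Rightarrow> 'n \<Rightarrow> 'n \<Rightarrow> real" where
  "angular F y i j = fund_tensor F y $ i $ j - vpartial i F y * vpartial j F y"

definition cartan :: "(real ^ 'n::finite \<Rightarrow> real) \<Rightarrow> real ^ 'n \<Rightarrow> 'n \<Rightarrow> 'n \<Rightarrow> 'n \<Rightarrow> real" where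
  "cartan F y i j k = 1/2 * vpartial k (\<lambda>z. fund_tensor F z $ i $ j) y"

definition cartan_trace :: "(real ^ 'n::finite \<Rightarrow> real) \<Rightarrow> real ^ 'n \<Rightarrow> 'n \<Rightarrow> real" where
  "cartan_trace F y i = (\<Sum>j\<in>UNIV. \<Sum>k\<in>UNIV. cartan F y i j k * fund_inverse F y $ j $ k)"


section \<open>Finsler spaces\<close>

text \<open>The Finsler function is defined on an open conic part \<open>T\<close> of the slit tangent bundle (a Kropina
  metric, for instance, is not defined where \<open>\<beta> = 0\<close>). The fundamental tensor is only required to be
  nondegenerate, and \<open>T\<close> need not meet every fibre.\<close>

definition finsler_space ::
  "'a topology \<Rightarrow> ('a, 'n::finite) chart set \<Rightarrow> ('a \<times> ('a, 'n) tvec) set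
     \<Rightarrow> ('a \<times> ('a, 'n) tvec \<Rightarrow> real) \<Rightarrow> bool" where
  "finsler_space X \<A> T F \<longleftrightarrow>
     T \<subseteq> slit_tangent_bundle X \<A> \<and>
     (\<forall>(p, v)\<in>T. 0 < F (p, v)) \<and>
     (\<forall>(p, v)\<in>T. \<forall>t>0. (p, \<lambda>c. t *\<^sub>R v c) \<in> T \<and> F (p, \<lambda>c. t *\<^sub>R v c) = t * F (p, v)) \<and>
     (\<forall>c\<in>\<A>. open (coord_set \<A> c T) \<and>
        smooth_on (coord_set \<A> c T) (\<lambda>(x, y). local_rep \<A> c F x y) \<and>
        (\<forall>(x, y)\<in>coord_set \<A> c T. invertible (fund_tensor (local_rep \<A> c F x) y)))"

text \<open>Positive definiteness is automatic here: \<open>g\<^sub>i\<^sub>j(x) y\<^sup>i y\<^sup>j = L\<^sup>2 > 0\<close> for all \<open>y \<noteq> 0\<close>.\<close>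

definition riemannian_space ::
  "'a topology \<Rightarrow> ('a, 'n::finite) chart set \<Rightarrow> ('a \<times> ('a, 'n) tvec \<Rightarrow> real) \<Rightarrow> bool" where
  "riemannian_space X \<A> L \<longleftrightarrow>
     finsler_space X \<A> (slit_tangent_bundle X \<A>) L \<and>
     (\<forall>c\<in>\<A>. \<forall>x\<in>snd c ` fst c. \<forall>y y'. y \<noteq> 0 \<longrightarrow> y' \<noteq> 0 \<longrightarrow>
        fund_tensor (local_rep \<A> c L x) y = fund_tensor (local_rep \<A> c L x) y')"

definition C_reducible ::
  "('a, 'n::finite) chart set \<Rightarrow> ('a \<times> ('a, 'n) tvec) set \<Rightarrow> ('a \<times> ('a, 'n) tvec \<Rightarrow> real) \<Rightarrow> bool" where
  "C_reducible \<A> T F \<longleftrightarrow>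
     (\<forall>c\<in>\<A>. \<forall>(x, y)\<in>coord_set \<A> c T. \<forall>i j k.
        let G = local_rep \<A> c F x in
        cartan G y i j k = 1 / (real CARD('n) + 1) *
          (angular G y i j * cartan_trace G y k + angular G y k i * cartan_trace G y j
             + angular G y j k * cartan_trace G y i))"


section \<open>Generalized \<open>\<beta>\<close>-conformal changes\<close>

text \<open>\<open>f\<close> is a function of the pair (rescaled \<open>L\<close>, \<open>\<beta>\<close>). Its domain lies in the half plane where the
  first variable is positive, as \<open>e\<^sup>\<sigma> L > 0\<close> on the slit tangent bundle; without this, connectedness
  of \<open>D\<close> would say nothing about the part of \<open>D\<close> in which values are taken.\<close>

definition change_function :: "(real \<times> real) set \<Rightarrow> (real \<times> real \<Rightarrow> real) \<Rightarrow> bool" where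
  "change_function D f \<longleftrightarrow>
     open D \<and> connected D \<and> D \<subseteq> {(u, v). 0 < u} \<and> smooth_on D f \<and>
     (\<forall>(u, v)\<in>D. \<forall>t>0. (t * u, t * v) \<in> D \<and> f (t * u, t * v) = t * f (u, v))"

definition change_arg ::
  "('a \<Rightarrow> real) \<Rightarrow> ('a \<times> ('a, 'n) tvec \<Rightarrow> real) \<Rightarrow> ('a \<times> ('a, 'n) tvec \<Rightarrow> real)
     \<Rightarrow> 'a \<times> ('a, 'n) tvec \<Rightarrow> real \<times> real" where
  "change_arg \<sigma> L \<beta> w = (exp (\<sigma> (fst w)) * L w, \<beta> w)"

definition change_domain ::
  "'a topology \<Rightarrow> ('a, 'n::finite) chart set \<Rightarrow> (real \<times> real) set \<Rightarrow> ('a \<Rightarrow> real)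
     \<Rightarrow> ('a \<times> ('a, 'n) tvec \<Rightarrow> real) \<Rightarrow> ('a \<times> ('a, 'n) tvec \<Rightarrow> real)
     \<Rightarrow> ('a \<times> ('a, 'n) tvec) set" where
  "change_domain X \<A> D \<sigma> L \<beta> = {w \<in> slit_tangent_bundle X \<A>. change_arg \<sigma> L \<beta> w \<in> D}"

definition changed_metric ::
  "(real \<times> real \<Rightarrow> real) \<Rightarrow> ('a \<Rightarrow> real) \<Rightarrow> ('a \<times> ('a, 'n) tvec \<Rightarrow> real)
     \<Rightarrow> ('a \<times> ('a, 'n) tvec \<Rightarrow> real) \<Rightarrow> 'a \<times> ('a, 'n) tvec \<Rightarrow> real" where
  "changed_metric f \<sigma> L \<beta> w = f (change_arg \<sigma> L \<beta> w)"

definition D1 :: "(real \<times> real \<Rightarrow> real) \<Rightarrow> real \<times> real \<Rightarrow> real" where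
  "D1 f = (\<lambda>(u, v). deriv (\<lambda>t. f (t, v)) u)"

definition D2 :: "(real \<times> real \<Rightarrow> real) \<Rightarrow> real \<times> real \<Rightarrow> real" where
  "D2 f = (\<lambda>(u, v). deriv (\<lambda>t. f (u, t)) v)"

text \<open>Coefficients at \<open>w = (e\<^sup>\<sigma> L, \<beta>)\<close>; \<open>l\<close> is the value of \<open>L\<close>, \<open>s\<close> the value of \<open>\<sigma>\<close>, \<open>msq\<close> the value of
  \<open>m\<^sup>2\<close>, and \<open>n\<close> the dimension.\<close>

definition coef_p :: "(real \<times> real \<Rightarrow> real) \<Rightarrow> real \<Rightarrow> real \<times> real \<Rightarrow> real" where
  "coef_p f l w = f w * D1 f w / l"

definition coef_q0 :: "(real \<times> real \<Rightarrow> real) \<Rightarrow> real \<times> real \<Rightarrow> real" where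
  "coef_q0 f w = f w * D2 (D2 f) w"

definition coef_p0 :: "(real \<times> real \<Rightarrow> real) \<Rightarrow> real \<times> real \<Rightarrow> real" where
  "coef_p0 f w = (D2 f w)\<^sup>2 + coef_q0 f w"

definition coef_pm1 :: "(real \<times> real \<Rightarrow> real) \<Rightarrow> real \<Rightarrow> real \<times> real \<Rightarrow> real" where
  "coef_pm1 f l w = f w * D2 (D1 f) w / l + coef_p f l w * D2 f w / f w"

definition coef_p02 :: "(real \<times> real \<Rightarrow> real) \<Rightarrow> real \<times> real \<Rightarrow> real" where
  "coef_p02 f w = D2 (coef_p0 f) w"

definition coef_s0 ::
  "(real \<times> real \<Rightarrow> real) \<Rightarrow> real \<Rightarrow> real \<Rightarrow> real \<Rightarrow> real \<times> real \<Rightarrow> real" where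
  "coef_s0 f s l msq w =
     exp (- s) * coef_q0 f w / (coef_p f l w * (exp s * coef_p f l w + msq * coef_q0 f w))"

definition coef_lambda ::
  "nat \<Rightarrow> (real \<times> real \<Rightarrow> real) \<Rightarrow> real \<Rightarrow> real \<Rightarrow> real \<Rightarrow> real \<times> real \<Rightarrow> real" where
  "coef_lambda n f s l msq w =
     (real n + 1) * coef_pm1 f l w / (2 * coef_p f l w)
       - 3 * exp s * coef_pm1 f l w * msq * coef_s0 f s l msq w / 2
       + coef_p02 f w * msq / (2 * (exp s * coef_p f l w + coef_q0 f w * msq))"

definition alpha1 ::
  "nat \<Rightarrow> (real \<times> real \<Rightarrow> real) \<Rightarrow> real \<Rightarrow> real \<Rightarrow> real \<Rightarrow> real \<times> real \<Rightarrow> real" where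
  "alpha1 n f s l msq w =
     exp s * coef_pm1 f l w / 2 - exp s * coef_p f l w * coef_lambda n f s l msq w / (real n + 1)"

definition alpha2 ::
  "nat \<Rightarrow> (real \<times> real \<Rightarrow> real) \<Rightarrow> real \<Rightarrow> real \<Rightarrow> real \<Rightarrow> real \<times> real \<Rightarrow> real" where
  "alpha2 n f s l msq w =
     coef_p02 f w / 6 - coef_q0 f w * coef_lambda n f s l msq w / (real n + 1)"

definition m_covec :: "(real ^ 'n::finite \<Rightarrow> real) \<Rightarrow> real ^ 'n \<Rightarrow> real ^ 'n \<Rightarrow> real ^ 'n" where
  "m_covec F b y = b - ((b \<bullet> y) / (F y)\<^sup>2) *\<^sub>R lower_y F y"

definition m_square :: "(real ^ 'n::finite \<Rightarrow> real) \<Rightarrow> real ^ 'n \<Rightarrow> real ^ 'n \<Rightarrow> real" where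
  "m_square F b y =
     (\<Sum>i\<in>UNIV. \<Sum>j\<in>UNIV. fund_inverse F y $ i $ j * m_covec F b y $ i * m_covec F b y $ j)"

text \<open>The vanishing of both coefficients is required at those points of the domain where their
  denominators and the vector \<open>m\<close> do not vanish.\<close>

definition alphas_vanish ::
  "('a, 'n::finite) chart set \<Rightarrow> ('a \<times> ('a, 'n) tvec) set \<Rightarrow> (real \<times> real \<Rightarrow> real) \<Rightarrow> ('a \<Rightarrow> real)
     \<Rightarrow> ('a \<times> ('a, 'n) tvec \<Rightarrow> real) \<Rightarrow> ('a \<times> ('a, 'n) tvec \<Rightarrow> real) \<Rightarrow> bool" where
  "alphas_vanish \<A> T f \<sigma> L \<beta> \<longleftrightarrow>
     (\<forall>c\<in>\<A>. \<forall>(x, y)\<in>coord_set \<A> c T.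
        let w = change_arg \<sigma> L \<beta> (bundle_point \<A> c x y);
            F = local_rep \<A> c L x;
            b = form_components \<A> c \<beta> x;
            s = \<sigma> (chart_inv c x);
            msq = m_square F b y;
            p = coef_p f (F y) w
        in m_covec F b y \<noteq> 0 \<longrightarrow> msq \<noteq> 0 \<longrightarrow> p \<noteq> 0 \<longrightarrow> exp s * p + msq * coef_q0 f w \<noteq> 0 \<longrightarrow>
           alpha1 CARD('n) f s (F y) msq w = 0 \<and> alpha2 CARD('n) f s (F y) msq w = 0)"

text \<open>In the next two definitions \<open>W\<close> is the set of attained values of the pair (rescaled \<open>L\<close>, \<open>\<beta>\<close>).
  The sign conditions express that the root and the quotient are defined, since \<open>sqrt\<close> and \<open>/\<close> are
  total.\<close>

definition randers_type :: "(real \<times> real) set \<Rightarrow> (real \<times> real \<Rightarrow> real) \<Rightarrow> bool" where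
  "randers_type W f \<longleftrightarrow>
     (\<exists>c1 c2. \<forall>(u, v)\<in>W. f (u, v) = c2 * u + c1 * v) \<or>
     (\<exists>c0 c3 c4 c5. c0 \<noteq> 0 \<and> c4 \<noteq> 0 \<and>
        (\<forall>(u, v)\<in>W. 0 \<le> c3 * v\<^sup>2 + c4 * u\<^sup>2 \<and> f (u, v) = c0 * sqrt (c3 * v\<^sup>2 + c4 * u\<^sup>2) + c5 * v))"

definition kropina_type :: "(real \<times> real) set \<Rightarrow> (real \<times> real \<Rightarrow> real) \<Rightarrow> bool" where
  "kropina_type W f \<longleftrightarrow>
     (\<exists>c6 c7. c6 \<noteq> 0 \<and> (\<forall>(u, v)\<in>W. v \<noteq> 0 \<and> f (u, v) = c6 * u\<^sup>2 / v + c7 * v))"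

end

theory Submission
  imports Defs
begin

text \<open>
  All three conditions are turned into one ordinary differential equation for the profile
  \<open>\<psi>(t) = f(1, t)\<close> of the change.

  Fix a point and a chart. With \<open>A = e\<^sup>2\<^sup>\<sigma> g\<close>, a Euclidean inner product on the tangent space, and its
  norm \<open>u = e\<^sup>\<sigma> L\<close>, homogeneity gives \<open>f(u, v) = u \<psi>(v / u)\<close>. So the changed metric is
  \<open>F = u \<psi>(t)\<close> with the slope \<open>t = \<beta> / u\<close>, and \<open>\<partial>\<^sub>i u = l\<^sub>i\<close>, \<open>\<partial>\<^sub>i t = m\<^sub>i / u\<close>. Put \<open>\<chi> = \<psi> - t \<psi>'\<close>.
  Differentiating \<open>F\<^sup>2\<close> twice and three times yields
    \<open>gbar\<^sub>i\<^sub>j = F\<^sub>i F\<^sub>j + hbar\<^sub>i\<^sub>j\<close>, \<open>hbar\<^sub>i\<^sub>j = \<psi> \<chi> h\<^sub>i\<^sub>j + \<psi> \<psi>'' m\<^sub>i m\<^sub>j\<close> (\<open>fund_tensor_F\<close>) and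
    \<open>Cbar\<^sub>i\<^sub>j\<^sub>k = a (hbar\<^sub>i\<^sub>j m\<^sub>k + hbar\<^sub>j\<^sub>k m\<^sub>i + hbar\<^sub>k\<^sub>i m\<^sub>j) + c m\<^sub>i m\<^sub>j m\<^sub>k\<close> (\<open>cartan_F\<close>),
  where \<open>c\<close> is a nonzero multiple of \<open>\<chi> \<psi>''' + 3 t (\<psi>'')\<^sup>2\<close>. The first summand of \<open>Cbar\<close> is already of
  C-reducible form. The second one is not, unless it vanishes, because \<open>hbar\<close> has rank \<open>n - 1 \<ge> 2\<close>
  (\<open>semi_C_reducible_is_C_reducible_iff\<close>). Hence C-reducibility at \<open>y\<close> means that \<open>m = 0\<close> or
    \<open>\<chi> \<psi>''' + 3 t (\<psi>'')\<^sup>2 = 0\<close> at the slope of \<open>y\<close> (\<open>C_reducible_fibre_iff\<close>).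
  The coefficients \<open>\<alpha>\<^sub>1\<close>, \<open>\<alpha>\<^sub>2\<close> vanish together exactly if \<open>p p\<^sub>0\<^sub>2 = 3 q\<^sub>0 p\<^sub>-\<^sub>1\<close> (\<open>alphas_zero_iff\<close>), and after
  inserting the profile this is the same equation. The nonvanishing of \<open>p\<close> and \<open>e\<^sup>\<sigma> p + m\<^sup>2 q\<^sub>0\<close> is forced
  by the nondegeneracy of \<open>gbar\<close>.

  The equation is solved by quadrature. Since \<open>\<chi>' = - t \<psi>''\<close>, it says that \<open>\<psi>'' / \<chi>\<^sup>3\<close> is a constant \<open>k\<close>,
  and then \<open>1 / \<chi>\<^sup>2 - k t\<^sup>2\<close> is a constant \<open>c\<close>. If \<open>c \<noteq> 0\<close> the solutions are
  \<open>a \<surd>(k t\<^sup>2 + c) + d t\<close>, which is Randers type; if \<open>c = 0\<close> they are \<open>a / t + d t\<close>, which is Kropina type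
  (\<open>randers_or_kropina_if_ode\<close>).

  Globally the equation holds at the slopes \<open>t\<close> with \<open>m \<noteq> 0\<close>. From \<open>m\<^sup>2 = |b|\<^sup>2 - t\<^sup>2\<close> (norms with respect
  to \<open>A\<close>) these are the slopes in the domain of \<open>\<psi>\<close> with \<open>|t| < |b(x)|\<close> for some point \<open>x\<close>. They form
  a single open interval, whatever the topology of the manifold, because the intervals \<open>|t| < |b(x)|\<close>
  all have the centre 0. So the solution has the same constants everywhere. The remaining attained
  slopes have \<open>|t| = |b(x)|\<close>; they are limits of the former ones, and continuity of \<open>\<psi>\<close> covers them,
  except when \<open>\<beta>\<close> vanishes wherever the change is defined, in which case \<open>f\<close> is linear in its first
  argument on the attained values.
\<close>

section \<open>Symmetric matrices\<close>

lemma matrix_inv_mult: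
  fixes G :: "real ^ 'n::finite ^ 'n"
  assumes "invertible G"
  shows "G ** matrix_inv G = mat 1" "matrix_inv G ** G = mat 1"
  using assms someI_ex[of "\<lambda>B. G ** B = mat 1 \<and> B ** G = mat 1"]
  unfolding invertible_def matrix_inv_def by blast+

lemma matrix_inv_vector:
  fixes G :: "real ^ 'n::finite ^ 'n"
  assumes "invertible G"
  shows "G *v (matrix_inv G *v x) = x" "matrix_inv G *v (G *v x) = x"
  using assms by (simp_all add: matrix_vector_mul_assoc matrix_inv_mult)

lemma symmetric_matrix_inv:
  fixes G :: "real ^ 'n::finite ^ 'n"
  assumes "invertible G" "\<And>i j. G $ i $ j = G $ j $ i"
  shows "matrix_inv G $ i $ j = matrix_inv G $ j $ i"
proof -
  have "transpose G = G" using assms(2) by (simp add: transpose_def vec_eq_iff)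
  then have "G ** transpose (matrix_inv G) = mat 1"
    using matrix_transpose_mul[of "matrix_inv G" G] by (simp add: matrix_inv_mult(2)[OF assms(1)])
  then have "matrix_inv G = (matrix_inv G ** G) ** transpose (matrix_inv G)"
    by (simp add: matrix_mul_assoc[symmetric])
  then have "transpose (matrix_inv G) = matrix_inv G"
    by (simp add: matrix_inv_mult(2)[OF assms(1)])
  then have "transpose (matrix_inv G) $ i $ j = matrix_inv G $ i $ j" by (rule arg_cong)
  then show ?thesis by (simp only: transpose_def vec_lambda_beta)
qed

lemma inner_symmetric_matrix:
  fixes G :: "real ^ 'n::finite ^ 'n"
  assumes "\<And>i j. G $ i $ j = G $ j $ i"
  shows "x \<bullet> (G *v y) = y \<bullet> (G *v x)"
proof -
  have "transpose G = G" using assms by (simp add: transpose_def vec_eq_iff)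
  then show ?thesis by (metis dot_lmul_matrix inner_commute transpose_matrix_vector)
qed

lemma quadratic_form_sum:
  fixes G :: "real ^ 'n::finite ^ 'n"
  shows "(\<Sum>i\<in>UNIV. \<Sum>j\<in>UNIV. G $ i $ j * x $ i * y $ j) = x \<bullet> (G *v y)"
  by (simp add: inner_vec_def matrix_vector_mult_def sum_distrib_left algebra_simps)

text \<open>This is where the dimension enters: at least three dimensions leave a direction orthogonal to \<open>y\<close> and to
  \<open>b\<close>, on which \<open>h\<close> is positive and \<open>m\<close> vanishes.\<close>

lemma exists_orthogonal_to_pair:
  fixes a c :: "real ^ 'n::finite"
  assumes "CARD('n) \<ge> 3"
  obtains x where "x \<noteq> 0" "x \<bullet> a = 0" "x \<bullet> c = 0"
proof -
  have "dim {a, c} \<le> card {a, c}" by (simp add: dim_le_card')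
  also have "\<dots> \<le> 2" by (simp add: card_insert_if)
  finally have "dim {a, c} < DIM(real ^ 'n)" using assms by simp
  from orthogonal_to_subspace_exists[OF this] obtain x where "x \<noteq> 0" "\<And>y. y \<in> span {a, c} \<Longrightarrow> orthogonal x y"
    by blast
  then show ?thesis using that[of x] by (simp add: orthogonal_def span_base)
qed

section \<open>Partial derivatives along the coordinate axes\<close>

text \<open>A relation that, unlike \<open>vpartial\<close>, records that the derivative exists and so admits the usual
  differentiation rules.\<close>

definition has_vpartial :: "'n::finite \<Rightarrow> (real ^ 'n \<Rightarrow> real) \<Rightarrow> real \<Rightarrow> real ^ 'n \<Rightarrow> bool" where
  "has_vpartial i F d y \<longleftrightarrow> ((\<lambda>t. F (y + t *\<^sub>R axis i 1)) has_real_derivative d) (at 0)"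

lemma vpartial_eqI: "has_vpartial i F d y \<Longrightarrow> vpartial i F y = d"
  unfolding has_vpartial_def vpartial_def by (rule DERIV_imp_deriv)

lemma eventually_line_in_open:
  fixes y w :: "'a::real_normed_vector"
  assumes "open U" "y \<in> U"
  shows "eventually (\<lambda>t. y + t *\<^sub>R w \<in> U) (nhds (0::real))"
proof -
  have "((\<lambda>t. y + t *\<^sub>R w) \<longlongrightarrow> y + 0 *\<^sub>R w) (nhds 0)"
    by (intro tendsto_intros filterlim_ident)
  then show ?thesis
    using topological_tendstoD[OF _ assms(1)] assms(2) by fastforce
qed

lemma has_vpartial_transform:
  assumes "has_vpartial i F d y" "open U" "y \<in> U" "\<And>z. z \<in> U \<Longrightarrow> F z = G z"
  shows "has_vpartial i G d y"
proof -
  have "eventually (\<lambda>t. F (y + t *\<^sub>R axis i 1) = G (y + t *\<^sub>R axis i 1)) (nhds 0)"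
    using eventually_line_in_open[OF assms(2,3), of "axis i 1"] by eventually_elim (use assms(4) in auto)
  then show ?thesis
    using assms(1) unfolding has_vpartial_def by (subst (asm) DERIV_cong_ev) auto
qed

lemma vpartial_cong:
  assumes "open U" "y \<in> U" "\<And>z. z \<in> U \<Longrightarrow> F z = G z"
  shows "vpartial i F y = vpartial i G y"
proof -
  have "eventually (\<lambda>t. F (y + t *\<^sub>R axis i 1) = G (y + t *\<^sub>R axis i 1)) (nhds 0)"
    using eventually_line_in_open[OF assms(1,2), of "axis i 1"] by eventually_elim (use assms(3) in auto)
  then show ?thesis unfolding vpartial_def by (intro deriv_cong_ev) auto
qed

text \<open>The tensors of a metric are local: the metrics of interest are known in closed form only on an open
  cone, and are arbitrary outside.\<close>

lemma fund_tensor_cong: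
  assumes "open U" "y \<in> U" "\<And>z. z \<in> U \<Longrightarrow> F z = G z"
  shows "fund_tensor F y = fund_tensor G y"
proof -
  have "vpartial i (vpartial j (\<lambda>z. (F z)\<^sup>2)) y = vpartial i (vpartial j (\<lambda>z. (G z)\<^sup>2)) y" for i j
    by (intro vpartial_cong[OF assms(1,2)] vpartial_cong[OF assms(1)]) (auto simp: assms(3))
  then show ?thesis by (simp add: fund_tensor_def)
qed

lemma cartan_cong:
  assumes "open U" "y \<in> U" "\<And>z. z \<in> U \<Longrightarrow> F z = G z"
  shows "cartan F y i j k = cartan G y i j k"
  unfolding cartan_def
  by (intro arg_cong[where f = "\<lambda>x. 1/2 * x"] vpartial_cong[OF assms(1,2)])
     (simp add: fund_tensor_cong[OF assms(1) _ assms(3)])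

lemma angular_cong:
  assumes "open U" "y \<in> U" "\<And>z. z \<in> U \<Longrightarrow> F z = G z"
  shows "angular F y i j = angular G y i j"
proof -
  have "vpartial k F y = vpartial k G y" for k
    using vpartial_cong[OF assms] .
  moreover have "fund_tensor F y = fund_tensor G y"
    using fund_tensor_cong[OF assms] .
  ultimately show ?thesis by (simp add: angular_def)
qed

lemma cartan_trace_cong:
  assumes "open U" "y \<in> U" "\<And>z. z \<in> U \<Longrightarrow> F z = G z"
  shows "cartan_trace F y i = cartan_trace G y i"
  unfolding cartan_trace_def fund_inverse_def
  by (simp add: fund_tensor_cong[OF assms] cartan_cong[OF assms])

section \<open>A Euclidean norm and a linear form on one tangent space\<close>

text \<open>One tangent space with the rescaled metric \<open>A = e\<^sup>2\<^sup>\<sigma> g\<close> and the components \<open>b\<close> of the 1-form. Working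
  with \<open>A\<close> in place of \<open>g\<close> absorbs the conformal factor; the vectors \<open>m\<close> formed from \<open>g\<close> and from \<open>A\<close>
  coincide.\<close>

locale euclidean_fibre =
  fixes A :: "real ^ 'n::finite ^ 'n" and b :: "real ^ 'n"
  assumes A_sym: "A $ i $ j = A $ j $ i"
    and A_pos: "y \<noteq> 0 \<Longrightarrow> 0 < y \<bullet> (A *v y)"
begin

text \<open>With \<open>nrm\<close> as the Finsler function, \<open>lcov\<close>, \<open>mcov\<close>, \<open>hmet\<close> are the classical \<open>l\<^sub>i\<close>, \<open>m\<^sub>i\<close>, \<open>h\<^sub>i\<^sub>j\<close>. The
  slope is the homogeneous coordinate of the pair of arguments of \<open>f\<close>.\<close>

definition nrm :: "real ^ 'n \<Rightarrow> real" where "nrm y = sqrt (y \<bullet> (A *v y))"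
definition slope :: "real ^ 'n \<Rightarrow> real" where "slope y = (b \<bullet> y) / nrm y"
definition lcov :: "real ^ 'n \<Rightarrow> real ^ 'n" where "lcov y = (1 / nrm y) *\<^sub>R (A *v y)"
definition mcov :: "real ^ 'n \<Rightarrow> real ^ 'n" where "mcov y = b - slope y *\<^sub>R lcov y"
definition hmet :: "real ^ 'n \<Rightarrow> 'n \<Rightarrow> 'n \<Rightarrow> real" where
  "hmet y i j = A $ i $ j - lcov y $ i * lcov y $ j"

lemma A_inner_commute: "x \<bullet> (A *v y) = y \<bullet> (A *v x)"
  by (rule inner_symmetric_matrix[OF A_sym])

lemma nrm_pos: "y \<noteq> 0 \<Longrightarrow> 0 < nrm y"
  using A_pos by (simp add: nrm_def)

lemma nrm_sq: "(nrm y)\<^sup>2 = y \<bullet> (A *v y)"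
  using A_pos[of y] by (cases "y = 0") (auto simp: nrm_def)

lemma inner_lcov_self: "y \<noteq> 0 \<Longrightarrow> y \<bullet> lcov y = nrm y"
  using nrm_pos[of y] nrm_sq[of y] by (simp add: lcov_def power2_eq_square divide_eq_eq)

lemma inner_mcov_self: "y \<noteq> 0 \<Longrightarrow> y \<bullet> mcov y = 0"
  using nrm_pos[of y] inner_lcov_self[of y]
  by (simp add: mcov_def slope_def inner_diff_right inner_commute[of y b])

lemma has_vpartial_nrm:
  assumes "y \<noteq> 0"
  shows "has_vpartial i nrm (lcov y $ i) y"
proof -
  let ?e = "axis i 1 :: real ^ 'n"
  have eq: "(y + t *\<^sub>R ?e) \<bullet> (A *v (y + t *\<^sub>R ?e)) =
      y \<bullet> (A *v y) + 2 * t * (?e \<bullet> (A *v y)) + t\<^sup>2 * (?e \<bullet> (A *v ?e))" for t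
    by (simp add: algebra_simps matrix_vector_right_distrib matrix_vector_mult_scaleR inner_add_left
        inner_add_right A_inner_commute[of y ?e] power2_eq_square)
  have "y \<bullet> (A *v y) > 0" using A_pos assms by blast
  then have "((\<lambda>t. nrm (y + t *\<^sub>R ?e)) has_real_derivative (?e \<bullet> (A *v y)) / nrm y) (at 0)"
    unfolding nrm_def eq by (auto intro!: derivative_eq_intros simp: divide_simps)
  then show ?thesis
    by (simp add: has_vpartial_def lcov_def inner_axis')
qed

lemma has_vpartial_lcov:
  assumes "y \<noteq> 0"
  shows "has_vpartial i (\<lambda>z. lcov z $ j) (hmet y i j / nrm y) y"
proof -
  let ?e = "axis i 1 :: real ^ 'n"
  have eq: "(A *v (y + t *\<^sub>R ?e)) $ j = (A *v y) $ j + t * A $ i $ j" for t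
    by (simp add: matrix_vector_right_distrib matrix_vector_mult_scaleR A_sym[of i j]
        matrix_vector_mul_component inner_axis)
  have "((\<lambda>t. nrm (y + t *\<^sub>R ?e)) has_real_derivative lcov y $ i) (at 0)"
    using has_vpartial_nrm[OF assms] unfolding has_vpartial_def .
  then have "((\<lambda>t. lcov (y + t *\<^sub>R ?e) $ j) has_real_derivative hmet y i j / nrm y) (at 0)"
    unfolding lcov_def vector_scaleR_component eq using nrm_pos[OF assms]
    by (auto intro!: derivative_eq_intros simp: hmet_def lcov_def field_simps)
  then show ?thesis unfolding has_vpartial_def .
qed

text \<open>The slope is homogeneous of degree 0, so its gradient annihilates \<open>y\<close>; \<open>mcov\<close> is the projection of \<open>b\<close>
  with this property. Every function of the slope therefore has a gradient along \<open>m\<close>, which is why only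
  \<open>h\<close> and \<open>m\<close> occur in the Cartan tensor.\<close>

lemma has_vpartial_slope:
  assumes "y \<noteq> 0"
  shows "has_vpartial i slope (mcov y $ i / nrm y) y"
proof -
  let ?e = "axis i 1 :: real ^ 'n"
  have eq: "b \<bullet> (y + t *\<^sub>R ?e) = b \<bullet> y + t * b $ i" for t
    by (simp add: inner_add_right inner_axis)
  have "((\<lambda>t. nrm (y + t *\<^sub>R ?e)) has_real_derivative lcov y $ i) (at 0)"
    using has_vpartial_nrm[OF assms] unfolding has_vpartial_def .
  then have "((\<lambda>t. slope (y + t *\<^sub>R ?e)) has_real_derivative mcov y $ i / nrm y) (at 0)"
    unfolding slope_def eq using nrm_pos[OF assms]
    by (auto intro!: derivative_eq_intros simp: mcov_def slope_def field_simps)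
  then show ?thesis unfolding has_vpartial_def .
qed

lemma has_vpartial_mcov:
  assumes "y \<noteq> 0"
  shows "has_vpartial i (\<lambda>z. mcov z $ j) (- (mcov y $ i * lcov y $ j + slope y * hmet y i j) / nrm y) y"
  using has_vpartial_slope[OF assms, of i] has_vpartial_lcov[OF assms, of i j] nrm_pos[OF assms]
  unfolding has_vpartial_def mcov_def[abs_def] vector_minus_component vector_scaleR_component
  by (auto intro!: derivative_eq_intros simp: field_simps)

lemma has_vpartial_hmet:
  assumes "y \<noteq> 0"
  shows "has_vpartial k (\<lambda>z. hmet z i j) (- (hmet y k i * lcov y $ j + lcov y $ i * hmet y k j) / nrm y) y"
  using has_vpartial_lcov[OF assms, of k i] has_vpartial_lcov[OF assms, of k j] nrm_pos[OF assms]
  unfolding has_vpartial_def hmet_def[of _ i j]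
  by (auto intro!: derivative_eq_intros simp: field_simps)

lemma hmet_sym: "hmet y i j = hmet y j i"
  by (simp add: hmet_def A_sym[of i j] mult.commute)

lemma continuous_on_nrm: "continuous_on S nrm"
  unfolding nrm_def[abs_def] by (intro continuous_intros matrix_vector_mult_linear_continuous_on)

lemma continuous_on_slope: "continuous_on (- {0}) slope"
  unfolding slope_def[abs_def] by (intro continuous_intros continuous_on_nrm) (use nrm_pos in force)

lemma invertible_A: "invertible A"
proof -
  have "x = 0" if "A *v x = 0" for x
    using A_pos[of x] that by fastforce
  then show ?thesis
    unfolding invertible_left_inverse matrix_left_invertible_ker by blast
qed

definition b_sq :: real where "b_sq = b \<bullet> (matrix_inv A *v b)"
definition m_sq :: "real ^ 'n \<Rightarrow> real" where "m_sq y = mcov y \<bullet> (matrix_inv A *v mcov y)"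

lemma m_sq_pos: "mcov y \<noteq> 0 \<Longrightarrow> 0 < m_sq y"
proof -
  assume m: "mcov y \<noteq> 0"
  let ?w = "matrix_inv A *v mcov y"
  have "?w \<noteq> 0" using m matrix_inv_vector(1)[OF invertible_A, of "mcov y"] by auto
  then have "0 < ?w \<bullet> (A *v ?w)" by (rule A_pos)
  then show ?thesis by (simp add: m_sq_def matrix_inv_vector[OF invertible_A] inner_commute)
qed

text \<open>Pythagoras for the splitting of \<open>b\<close> into its parts along and orthogonal to \<open>y\<close>: the former is
  \<open>slope y\<close> times the unit covector \<open>l\<close>.\<close>

lemma m_sq_eq:
  assumes "y \<noteq> 0"
  shows "m_sq y = b_sq - (slope y)\<^sup>2"
proof -
  let ?e = "matrix_inv A *v b"
  have u: "nrm y > 0" using nrm_pos assms .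
  have w: "matrix_inv A *v mcov y = ?e - (slope y / nrm y) *\<^sub>R y"
    by (simp add: mcov_def lcov_def matrix_vector_mult_diff_distrib matrix_vector_mult_scaleR
        matrix_inv_vector[OF invertible_A])
  have "lcov y \<bullet> ?e = slope y"
    using A_inner_commute[of ?e y]
    by (simp add: lcov_def slope_def matrix_inv_vector[OF invertible_A] inner_commute)
  then have "m_sq y = b_sq - slope y * slope y - (slope y / nrm y) * (y \<bullet> mcov y)"
    unfolding m_sq_def w by (simp add: mcov_def inner_diff_left inner_diff_right b_sq_def inner_commute algebra_simps)
  then show ?thesis by (simp add: inner_mcov_self[OF assms] power2_eq_square)
qed

text \<open>The Cauchy-Schwarz inequality for \<open>b \<bullet> y\<close>, together with its case of equality, read off from
  \<open>m\<^sup>2 = |b|\<^sup>2 - t\<^sup>2\<close>.\<close>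

lemma slope_range:
  assumes "y \<noteq> 0"
  shows "\<bar>slope y\<bar> \<le> sqrt b_sq" "mcov y \<noteq> 0 \<longleftrightarrow> \<bar>slope y\<bar> < sqrt b_sq"
proof -
  have m: "m_sq y = b_sq - (slope y)\<^sup>2" by (rule m_sq_eq[OF assms])
  have "0 \<le> m_sq y" using m_sq_pos[of y] by (cases "mcov y = 0") (auto simp: m_sq_def)
  then show "\<bar>slope y\<bar> \<le> sqrt b_sq" using m by (simp add: abs_le_square_iff real_le_rsqrt)
  have "mcov y \<noteq> 0 \<longleftrightarrow> 0 < m_sq y" using m_sq_pos[of y] by (auto simp: m_sq_def)
  also have "\<dots> \<longleftrightarrow> (slope y)\<^sup>2 < b_sq" by (simp add: m)
  also have "\<dots> \<longleftrightarrow> \<bar>slope y\<bar> < sqrt b_sq"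
    by (metis real_sqrt_abs real_sqrt_less_iff)
  finally show "mcov y \<noteq> 0 \<longleftrightarrow> \<bar>slope y\<bar> < sqrt b_sq" .
qed

lemma slope_attained:
  assumes n: "CARD('n) \<ge> 3" and t: "\<bar>t\<bar> < sqrt b_sq"
  obtains y where "y \<noteq> 0" "nrm y = 1" "slope y = t"
proof -
  let ?e = "matrix_inv A *v b"
  have B: "b_sq > 0" using t by (smt (verit) real_sqrt_gt_0_iff)
  obtain x where x: "x \<noteq> 0" "x \<bullet> b = 0" using exists_orthogonal_to_pair[OF n] by metis
  define z where "z = (1 / nrm x) *\<^sub>R x"
  have u: "nrm x > 0" using nrm_pos x(1) .
  have z: "z \<bullet> (A *v z) = 1" "z \<bullet> b = 0"
    using u nrm_sq[of x] A_pos[OF x(1)] x(2)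
    by (simp_all add: z_def matrix_vector_mult_scaleR power2_eq_square field_simps)
  have "t\<^sup>2 < b_sq" using t by (metis real_sqrt_abs real_sqrt_less_iff)
  then have g: "0 \<le> 1 - t\<^sup>2 / b_sq" using B by simp
  define \<gamma> where "\<gamma> = sqrt (1 - t\<^sup>2 / b_sq)"
  have \<gamma>: "\<gamma>\<^sup>2 = 1 - t\<^sup>2 / b_sq" using g by (simp add: \<gamma>_def)
  (* The first summand, dual to b, sets b \<bullet> y = t; the second one, orthogonal to it, fills up the norm to 1. *)
  define y where "y = (t / b_sq) *\<^sub>R ?e + \<gamma> *\<^sub>R z"
  have Ay: "A *v y = (t / b_sq) *\<^sub>R b + \<gamma> *\<^sub>R (A *v z)"
    by (simp add: y_def matrix_vector_right_distrib matrix_vector_mult_scaleR matrix_inv_vector[OF invertible_A])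
  have eAz: "?e \<bullet> (A *v z) = 0"
    using A_inner_commute[of ?e z] z(2) by (simp add: matrix_inv_vector[OF invertible_A])
  have "y \<bullet> (A *v y) = (t / b_sq)\<^sup>2 * b_sq + \<gamma>\<^sup>2"
    unfolding Ay unfolding y_def using z eAz
    by (simp add: inner_add_left inner_add_right b_sq_def inner_commute power2_eq_square)
  also have "\<dots> = 1" unfolding \<gamma> using B by (simp add: power2_eq_square field_simps)
  finally have "nrm y = 1" by (simp add: nrm_def)
  moreover have "b \<bullet> y = t"
    using B z by (simp add: y_def inner_add_right b_sq_def[symmetric] inner_commute)
  moreover have "y \<noteq> 0" using \<open>nrm y = 1\<close> by (auto simp: nrm_def)
  ultimately show ?thesis using that[of y] by (simp add: slope_def)
qed

end

section \<open>The Cartan tensor of the changed metric\<close>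

text \<open>The changed metric on one tangent space, given by the profile \<open>\<psi>\<close>. Its three derivatives are parameters
  so that no differentiation operator occurs in the tensor computations.\<close>

locale fibre_change = euclidean_fibre A b for A :: "real ^ 'n::finite ^ 'n" and b +
  fixes I :: "real set" and \<psi> \<psi>1 \<psi>2 \<psi>3 :: "real \<Rightarrow> real"
  assumes open_I: "open I"
    and deriv0: "t \<in> I \<Longrightarrow> (\<psi> has_real_derivative \<psi>1 t) (at t)"
    and deriv1: "t \<in> I \<Longrightarrow> (\<psi>1 has_real_derivative \<psi>2 t) (at t)"
    and deriv2: "t \<in> I \<Longrightarrow> (\<psi>2 has_real_derivative \<psi>3 t) (at t)"
begin

text \<open>\<open>U\<close> is the cone on which the changed metric \<open>F\<close> is defined, \<open>dF\<close> its differential, and \<open>hbar\<close> its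
  angular metric; \<open>chi\<close> is the partial derivative \<open>f\<^sub>1\<close> in terms of the profile.\<close>

definition U :: "(real ^ 'n) set" where "U = {y. y \<noteq> 0 \<and> slope y \<in> I}"
definition F :: "real ^ 'n \<Rightarrow> real" where "F y = nrm y * \<psi> (slope y)"
definition chi :: "real \<Rightarrow> real" where "chi t = \<psi> t - t * \<psi>1 t"
definition dF :: "real ^ 'n \<Rightarrow> real ^ 'n" where
  "dF y = \<psi> (slope y) *\<^sub>R lcov y + \<psi>1 (slope y) *\<^sub>R mcov y"
definition hbar :: "real ^ 'n \<Rightarrow> 'n \<Rightarrow> 'n \<Rightarrow> real" where
  "hbar y i j = \<psi> (slope y) * chi (slope y) * hmet y i j
     + \<psi> (slope y) * \<psi>2 (slope y) * mcov y $ i * mcov y $ j"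

lemma open_U: "open U"
proof -
  have "open ((- {0}) \<inter> slope -` I)"
    by (rule continuous_open_preimage[OF continuous_on_slope _ open_I]) auto
  moreover have "U = (- {0}) \<inter> slope -` I" by (auto simp: U_def)
  ultimately show ?thesis by simp
qed

lemma has_vpartial_comp_slope:
  assumes "y \<noteq> 0" "(\<phi> has_real_derivative d) (at (slope y))"
  shows "has_vpartial i (\<lambda>z. \<phi> (slope z)) (d * mcov y $ i / nrm y) y"
proof -
  have "((\<lambda>t. slope (y + t *\<^sub>R axis i 1)) has_real_derivative mcov y $ i / nrm y) (at 0)"
    using has_vpartial_slope[OF assms(1)] unfolding has_vpartial_def .
  moreover have "(\<phi> has_real_derivative d) (at (slope (y + 0 *\<^sub>R axis i 1)))" using assms(2) by simp
  ultimately have "((\<lambda>t. \<phi> (slope (y + t *\<^sub>R axis i 1))) has_real_derivative d * (mcov y $ i / nrm y)) (at 0)"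
    by (rule DERIV_chain2[rotated])
  then show ?thesis unfolding has_vpartial_def by simp
qed

lemma deriv_chi: "t \<in> I \<Longrightarrow> (chi has_real_derivative - t * \<psi>2 t) (at t)"
  unfolding chi_def[abs_def] by (auto intro!: derivative_eq_intros deriv0 deriv1)

lemma has_vpartial_F:
  assumes "y \<in> U"
  shows "has_vpartial i F (dF y $ i) y"
proof -
  have y: "y \<noteq> 0" "slope y \<in> I" using assms by (auto simp: U_def)
  show ?thesis
    using has_vpartial_nrm[OF y(1), of i] has_vpartial_comp_slope[OF y(1) deriv0[OF y(2)], of i] nrm_pos[OF y(1)]
    unfolding has_vpartial_def F_def[abs_def]
    by (auto intro!: derivative_eq_intros simp: dF_def field_simps)
qed

lemma has_vpartial_dF:
  assumes "y \<in> U"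
  shows "has_vpartial i (\<lambda>z. dF z $ j)
    ((chi (slope y) * hmet y i j + \<psi>2 (slope y) * mcov y $ i * mcov y $ j) / nrm y) y"
proof -
  have y: "y \<noteq> 0" "slope y \<in> I" using assms by (auto simp: U_def)
  show ?thesis
    using has_vpartial_comp_slope[OF y(1) deriv0[OF y(2)], of i]
      has_vpartial_comp_slope[OF y(1) deriv1[OF y(2)], of i]
      has_vpartial_mcov[OF y(1), of i j] has_vpartial_lcov[OF y(1), of i j] nrm_pos[OF y(1)]
    unfolding has_vpartial_def dF_def[abs_def] vector_add_component vector_scaleR_component
    by (auto intro!: derivative_eq_intros simp: chi_def field_simps)
qed

lemma fund_tensor_F:
  assumes "y \<in> U"
  shows "fund_tensor F y $ i $ j = dF y $ i * dF y $ j + hbar y i j"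
proof -
  have y: "y \<noteq> 0" "slope y \<in> I" using assms by (auto simp: U_def)
  have 1: "vpartial j (\<lambda>z. (F z)\<^sup>2) z = 2 * F z * dF z $ j" if "z \<in> U" for z
    using has_vpartial_F[OF that, of j] 
    by (intro vpartial_eqI) (auto simp: has_vpartial_def intro!: derivative_eq_intros)
  have Fy: "F y = nrm y * \<psi> (slope y)" by (simp add: F_def)
  have "has_vpartial i (\<lambda>z. 2 * F z * dF z $ j) (2 * (dF y $ i * dF y $ j + hbar y i j)) y"
    using has_vpartial_F[OF assms, of i] has_vpartial_dF[OF assms, of i j] nrm_pos[OF y(1)]
    unfolding has_vpartial_def
    by (auto intro!: derivative_eq_intros simp: hbar_def Fy field_simps)
  then have "vpartial i (vpartial j (\<lambda>z. (F z)\<^sup>2)) y = 2 * (dF y $ i * dF y $ j + hbar y i j)"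
    by (intro vpartial_eqI, elim has_vpartial_transform[OF _ open_U assms]) (simp add: 1)
  then show ?thesis by (simp add: fund_tensor_def)
qed

lemma angular_F: "y \<in> U \<Longrightarrow> angular F y i j = hbar y i j"
  by (simp add: angular_def fund_tensor_F vpartial_eqI[OF has_vpartial_F])

text \<open>All terms containing \<open>l\<close> cancel, as they must since the Cartan tensor annihilates \<open>y\<close>.\<close>

lemma cartan_F:
  assumes "y \<in> U"
  defines "t \<equiv> slope y"
  shows "2 * nrm y * cartan F y i j k =
     (\<psi>1 t * chi t - t * \<psi> t * \<psi>2 t) *
       (hmet y i j * mcov y $ k + hmet y j k * mcov y $ i + hmet y k i * mcov y $ j)
     + (3 * \<psi>1 t * \<psi>2 t + \<psi> t * \<psi>3 t) * mcov y $ i * mcov y $ j * mcov y $ k"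
proof -
  have y: "y \<noteq> 0" "slope y \<in> I" using assms by (auto simp: U_def)
  let ?R = "((\<psi>1 t * chi t - t * \<psi> t * \<psi>2 t) *
       (hmet y i j * mcov y $ k + hmet y j k * mcov y $ i + hmet y k i * mcov y $ j)
     + (3 * \<psi>1 t * \<psi>2 t + \<psi> t * \<psi>3 t) * mcov y $ i * mcov y $ j * mcov y $ k) / nrm y"
  have "has_vpartial k (\<lambda>z. dF z $ i * dF z $ j + hbar z i j) ?R y"
    using has_vpartial_dF[OF assms(1), of k i] has_vpartial_dF[OF assms(1), of k j] nrm_pos[OF y(1)]
      has_vpartial_comp_slope[OF y(1) deriv0[OF y(2)], of k]
      has_vpartial_comp_slope[OF y(1) deriv_chi[OF y(2)], of k]
      has_vpartial_comp_slope[OF y(1) deriv2[OF y(2)], of k]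
      has_vpartial_mcov[OF y(1), of k i] has_vpartial_mcov[OF y(1), of k j]
      has_vpartial_hmet[OF y(1), of k i j]
    unfolding has_vpartial_def hbar_def[of _ i j]
    apply (auto intro!: derivative_eq_intros)
    apply (simp add: dF_def hmet_sym[of y k j] hmet_sym[of y k i] t_def[symmetric])
    apply (simp add: field_simps hmet_sym[of y k i])
    done
  then have "vpartial k (\<lambda>z. fund_tensor F z $ i $ j) y = ?R"
    by (intro vpartial_eqI, elim has_vpartial_transform[OF _ open_U assms(1)]) (simp add: fund_tensor_F)
  then show ?thesis using nrm_pos[OF y(1)] by (simp add: cartan_def)
qed

end

section \<open>C-reducibility on one tangent space\<close>

text \<open>Forming traces needs no formula for the inverse of \<open>G\<close>: from \<open>G y = r \<phi>\<close> one gets that the inverse maps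
  \<open>\<phi>\<close> to a multiple of \<open>y\<close>, and \<open>m\<close> annihilates \<open>y\<close>, so contraction of \<open>hb\<close> with the inverse metric acts
  as the identity on \<open>m\<close> and has trace \<open>n - 1\<close>. The trace of \<open>C\<close> is then a multiple of \<open>m\<close>, the terms with
  \<open>\<alpha>\<close> cancel, and what remains is \<open>\<gamma>\<close> times a tensor that is nonzero for \<open>m \<noteq> 0\<close>: contracting it twice
  with \<open>X\<close> kills \<open>m\<^sub>i m\<^sub>j m\<^sub>k\<close> but not the other term.\<close>

lemma semi_C_reducible_is_C_reducible_iff:
  fixes G :: "real ^ 'n::finite ^ 'n" and \<phi> m y X :: "real ^ 'n" and r \<alpha> \<gamma> :: real
  assumes inv: "invertible G" and sym: "\<And>i j. G $ i $ j = G $ j $ i"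
    and Gy: "G *v y = r *\<^sub>R \<phi>" and \<phi>y: "\<phi> \<bullet> y = r" and r: "r \<noteq> 0" and my: "m \<bullet> y = 0"
  defines "hb \<equiv> \<lambda>i j. G $ i $ j - \<phi> $ i * \<phi> $ j"
  defines "C \<equiv> \<lambda>i j k. \<alpha> * (hb i j * m $ k + hb j k * m $ i + hb k i * m $ j) + \<gamma> * m $ i * m $ j * m $ k"
  defines "tr \<equiv> \<lambda>i. \<Sum>j\<in>UNIV. \<Sum>k\<in>UNIV. C i j k * matrix_inv G $ j $ k"
  assumes Xm: "X \<bullet> m = 0" and hX: "(\<Sum>i\<in>UNIV. \<Sum>j\<in>UNIV. hb i j * X $ i * X $ j) \<noteq> 0"
  shows "(\<forall>i j k. C i j k = 1 / (real CARD('n) + 1) * (hb i j * tr k + hb k i * tr j + hb j k * tr i))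
     \<longleftrightarrow> \<gamma> = 0 \<or> m = 0"
proof -
  let ?n = "real CARD('n)"
  define Gi where "Gi = matrix_inv G"
  define w where "w = Gi *v m"
  define M where "M = m \<bullet> w"
  have Gi_sym: "Gi $ i $ j = Gi $ j $ i" for i j
    unfolding Gi_def by (rule symmetric_matrix_inv[OF inv sym])
  have hb_sym: "hb i j = hb j i" for i j using sym[of i j] by (simp add: hb_def)
  have Gw: "G *v w = m" by (simp add: w_def Gi_def matrix_inv_vector[OF inv])
  have "Gi *v (r *\<^sub>R \<phi>) = y" unfolding Gy[symmetric] by (simp add: Gi_def matrix_inv_vector[OF inv])
  then have Gi\<phi>: "Gi *v \<phi> = (1 / r) *\<^sub>R y"
    using r by (simp add: matrix_vector_mult_scaleR) (metis divide_inverse_commute inverse_eq_divide mult.commute mult_1 right_inverse scaleR_one scaleR_scaleR)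
  have \<phi>w: "\<phi> \<bullet> w = 0"
    using inner_symmetric_matrix[OF Gi_sym, of \<phi> m] my by (simp add: w_def Gi\<phi>)
  have hbw: "(\<Sum>j\<in>UNIV. hb i j * w $ j) = m $ i" for i
  proof -
    have "(\<Sum>j\<in>UNIV. hb i j * w $ j) = (G *v w) $ i - \<phi> $ i * (\<phi> \<bullet> w)"
      by (simp add: hb_def matrix_vector_mult_def inner_vec_def sum_subtractf sum_distrib_left algebra_simps)
    then show ?thesis by (simp add: Gw \<phi>w)
  qed
  have w_sum: "(\<Sum>k\<in>UNIV. m $ k * Gi $ j $ k) = w $ j" for j
    by (simp add: w_def matrix_vector_mult_def mult.commute)
  have s1: "(\<Sum>j\<in>UNIV. \<Sum>k\<in>UNIV. hb i j * m $ k * Gi $ j $ k) = m $ i" for i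
    by (simp add: mult.assoc sum_distrib_left[symmetric] w_sum hbw)
  have s3: "(\<Sum>j\<in>UNIV. \<Sum>k\<in>UNIV. hb k i * m $ j * Gi $ j $ k) = m $ i" for i
  proof -
    have "hb k i * m $ j * Gi $ j $ k = hb i k * m $ j * Gi $ k $ j" for j k
      using hb_sym[of k i] Gi_sym[of j k] by simp
    then have "(\<Sum>j\<in>UNIV. \<Sum>k\<in>UNIV. hb k i * m $ j * Gi $ j $ k)
        = (\<Sum>j\<in>UNIV. \<Sum>k\<in>UNIV. hb i k * m $ j * Gi $ k $ j)"
      by (intro sum.cong refl)
    also have "\<dots> = (\<Sum>k\<in>UNIV. \<Sum>j\<in>UNIV. hb i k * m $ j * Gi $ k $ j)" by (rule sum.swap)
    finally show ?thesis by (simp only: s1)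
  qed
  have "(\<Sum>j\<in>UNIV. \<Sum>k\<in>UNIV. hb j k * Gi $ j $ k)
      = (\<Sum>j\<in>UNIV. \<Sum>k\<in>UNIV. G $ j $ k * Gi $ k $ j) - \<phi> \<bullet> (Gi *v \<phi>)"
    by (simp add: quadratic_form_sum[symmetric] hb_def sum_subtractf algebra_simps Gi_sym)
  also have "(\<Sum>j\<in>UNIV. \<Sum>k\<in>UNIV. G $ j $ k * Gi $ k $ j) = (\<Sum>j\<in>UNIV. (G ** Gi) $ j $ j)"
    by (simp add: matrix_matrix_mult_def)
  also have "\<dots> = ?n" by (simp add: Gi_def matrix_inv_mult(1)[OF inv] mat_def)
  finally have s2': "(\<Sum>j\<in>UNIV. \<Sum>k\<in>UNIV. hb j k * Gi $ j $ k) = ?n - 1"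
    using r \<phi>y by (simp add: Gi\<phi>)
  have s2: "(\<Sum>j\<in>UNIV. \<Sum>k\<in>UNIV. hb j k * m $ i * Gi $ j $ k) = m $ i * (?n - 1)" for i
    unfolding s2'[symmetric] by (simp add: sum_distrib_left algebra_simps)
  have s4: "(\<Sum>j\<in>UNIV. \<Sum>k\<in>UNIV. m $ i * m $ j * m $ k * Gi $ j $ k) = m $ i * M" for i
    by (simp add: mult.assoc sum_distrib_left[symmetric] w_sum) (simp add: M_def inner_vec_def)
  have tr: "tr i = (\<alpha> * (?n + 1) + \<gamma> * M) * m $ i" for i
  proof -
    have "tr i = \<alpha> * ((\<Sum>j\<in>UNIV. \<Sum>k\<in>UNIV. hb i j * m $ k * Gi $ j $ k)
        + (\<Sum>j\<in>UNIV. \<Sum>k\<in>UNIV. hb j k * m $ i * Gi $ j $ k)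
        + (\<Sum>j\<in>UNIV. \<Sum>k\<in>UNIV. hb k i * m $ j * Gi $ j $ k))
        + \<gamma> * (\<Sum>j\<in>UNIV. \<Sum>k\<in>UNIV. m $ i * m $ j * m $ k * Gi $ j $ k)"
      unfolding tr_def C_def Gi_def[symmetric] by (simp add: sum_distrib_left sum.distrib algebra_simps)
    then show ?thesis unfolding s1 s2 s3 s4 by (simp add: algebra_simps)
  qed
  define S where "S i j k = hb i j * m $ k + hb j k * m $ i + hb k i * m $ j" for i j k
  have diff: "C i j k - 1 / (?n + 1) * (hb i j * tr k + hb k i * tr j + hb j k * tr i)
      = \<gamma> * (m $ i * m $ j * m $ k - M / (?n + 1) * S i j k)" for i j k
  proof -
    have [simp]: "?n + 1 \<noteq> 0" by linarith
    have "1 / (?n + 1) * (hb i j * tr k + hb k i * tr j + hb j k * tr i) = (\<alpha> + \<gamma> * M / (?n + 1)) * S i j k"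
      unfolding tr S_def by (simp add: field_simps)
    moreover have "C i j k = \<alpha> * S i j k + \<gamma> * (m $ i * m $ j * m $ k)" by (simp add: C_def S_def)
    ultimately show ?thesis by (simp only:) (simp add: algebra_simps)
  qed
  (* Contraction with X in the first two slots: the left-hand side and all terms of S but the first
     contain the factor X \<bullet> m = 0. *)
  have m0: "m = 0" if *: "\<And>i j k. m $ i * m $ j * m $ k = M / (?n + 1) * S i j k"
  proof -
    let ?hX = "\<Sum>i\<in>UNIV. \<Sum>j\<in>UNIV. hb i j * X $ i * X $ j"
    have Xm': "(\<Sum>i\<in>UNIV. X $ i * m $ i) = 0" using Xm by (simp add: inner_vec_def)
    have "M * m $ k = 0" for k
    proof -
      have "(\<Sum>i\<in>UNIV. \<Sum>j\<in>UNIV. X $ i * X $ j * S i j k)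
          = ?hX * m $ k + (\<Sum>i\<in>UNIV. X $ i * m $ i) * (\<Sum>j\<in>UNIV. X $ j * hb j k)
            + (\<Sum>i\<in>UNIV. X $ i * hb k i) * (\<Sum>j\<in>UNIV. X $ j * m $ j)"
        unfolding S_def sum_product by (simp add: sum.distrib sum_distrib_left sum_distrib_right algebra_simps)
      then have 1: "(\<Sum>i\<in>UNIV. \<Sum>j\<in>UNIV. X $ i * X $ j * S i j k) = ?hX * m $ k" by (simp add: Xm')
      have "(\<Sum>i\<in>UNIV. \<Sum>j\<in>UNIV. X $ i * X $ j * (m $ i * m $ j * m $ k))
          = (\<Sum>i\<in>UNIV. X $ i * m $ i) * (\<Sum>j\<in>UNIV. X $ j * m $ j) * m $ k"
        unfolding sum_product by (simp add: sum_distrib_left sum_distrib_right algebra_simps)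
      then have "0 = (\<Sum>i\<in>UNIV. \<Sum>j\<in>UNIV. X $ i * X $ j * (M / (?n + 1) * S i j k))"
        by (simp add: Xm' *)
      also have "\<dots> = M / (?n + 1) * (\<Sum>i\<in>UNIV. \<Sum>j\<in>UNIV. X $ i * X $ j * S i j k)"
        by (simp add: sum_distrib_left algebra_simps)
      finally have "M / (?n + 1) * (?hX * m $ k) = 0" by (simp add: 1)
      moreover have "?n + 1 \<noteq> 0" by linarith
      ultimately show ?thesis using hX by auto
    qed
    then have "M = 0 \<or> m = 0" by (auto simp: vec_eq_iff)
    moreover have "m = 0" if "M = 0"
      using *[of i i i for i] that by (simp add: vec_eq_iff)
    ultimately show "m = 0" by blast
  qed
  have "(\<forall>i j k. C i j k = 1 / (?n + 1) * (hb i j * tr k + hb k i * tr j + hb j k * tr i))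
     \<longleftrightarrow> (\<forall>i j k. \<gamma> * (m $ i * m $ j * m $ k - M / (?n + 1) * S i j k) = 0)"
    unfolding diff[symmetric] by simp
  also have "\<dots> \<longleftrightarrow> \<gamma> = 0 \<or> m = 0"
    using m0 by (auto simp: S_def)
  finally show ?thesis .
qed

text \<open>The left-hand side of the differential equation for the profile, namely
  \<open>f\<^sub>1 f\<^sub>2\<^sub>2\<^sub>2 - 3 f\<^sub>1\<^sub>2 f\<^sub>2\<^sub>2\<close> at \<open>(1, t)\<close>.\<close>

definition profile_defect ::
  "(real \<Rightarrow> real) \<Rightarrow> (real \<Rightarrow> real) \<Rightarrow> (real \<Rightarrow> real) \<Rightarrow> (real \<Rightarrow> real) \<Rightarrow> real \<Rightarrow> real" where
  "profile_defect \<psi> \<psi>1 \<psi>2 \<psi>3 t = (\<psi> t - t * \<psi>1 t) * \<psi>3 t + 3 * t * (\<psi>2 t)\<^sup>2"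

context fibre_change
begin

abbreviation defect :: "real \<Rightarrow> real" where "defect \<equiv> profile_defect \<psi> \<psi>1 \<psi>2 \<psi>3"

lemma defect_eq: "defect t = chi t * \<psi>3 t + 3 * t * (\<psi>2 t)\<^sup>2"
  by (simp add: profile_defect_def chi_def)

lemma inner_dF_self: "y \<in> U \<Longrightarrow> dF y \<bullet> y = F y"
  using inner_lcov_self[of y] inner_mcov_self[of y]
  by (simp add: dF_def F_def U_def inner_add_right inner_commute[of _ y])

lemma fund_tensor_F_mult:
  assumes "y \<in> U"
  shows "fund_tensor F y *v x = (dF y \<bullet> x) *\<^sub>R dF y
    + (\<psi> (slope y) * chi (slope y)) *\<^sub>R (A *v x - (lcov y \<bullet> x) *\<^sub>R lcov y)
    + (\<psi> (slope y) * \<psi>2 (slope y) * (mcov y \<bullet> x)) *\<^sub>R mcov y"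
  by (simp add: vec_eq_iff matrix_vector_mult_def fund_tensor_F[OF assms] hbar_def hmet_def inner_vec_def
      sum.distrib sum_subtractf sum_distrib_left sum_distrib_right algebra_simps)

text \<open>Euler's relation for \<open>F\<close>, which is homogeneous of degree 1.\<close>

lemma fund_tensor_F_self:
  assumes "y \<in> U"
  shows "fund_tensor F y *v y = F y *\<^sub>R dF y"
proof -
  have y: "y \<noteq> 0" using assms by (simp add: U_def)
  have "A *v y = nrm y *\<^sub>R lcov y" using nrm_pos[OF y] by (simp add: lcov_def)
  then show ?thesis
    using inner_lcov_self[OF y] inner_mcov_self[OF y]
    by (simp add: fund_tensor_F_mult[OF assms] inner_dF_self[OF assms] inner_commute[of _ y]
        inner_dF_self[OF assms, unfolded inner_commute[of _ y]])
qed

text \<open>Otherwise the fundamental tensor would only involve \<open>dF\<close> and \<open>m\<close>, and would have rank at most 2 in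
  dimension at least 3.\<close>

lemma chi_nonzero:
  assumes n: "CARD('n) \<ge> 3" and y: "y \<in> U" and inv: "invertible (fund_tensor F y)"
  shows "\<psi> (slope y) * chi (slope y) \<noteq> 0"
proof
  assume 0: "\<psi> (slope y) * chi (slope y) = 0"
  obtain x where x: "x \<noteq> 0" "x \<bullet> lcov y = 0" "x \<bullet> b = 0"
    using exists_orthogonal_to_pair[OF n] by blast
  have "mcov y \<bullet> x = 0" "dF y \<bullet> x = 0"
    using x by (auto simp: mcov_def dF_def inner_diff_right inner_add_right inner_commute[of _ x])
  then have "fund_tensor F y *v x = 0" using 0 by (simp add: fund_tensor_F_mult[OF y])
  then show False using matrix_inv_vector(2)[OF inv, of x] x(1) by simp
qed

text \<open>If the coefficient vanished, \<open>hbar\<close> would annihilate the vector \<open>w\<close> dual to \<open>m\<close> in addition to \<open>y\<close>.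
  Then \<open>gbar\<close> maps \<open>w\<close> and \<open>y\<close> to multiples of \<open>dF\<close>, so \<open>w\<close> is parallel to \<open>y\<close>, while \<open>m\<close> annihilates
  \<open>y\<close> but not \<open>w\<close>.\<close>

lemma m_sq_coefficient_nonzero:
  assumes y: "y \<in> U" and inv: "invertible (fund_tensor F y)" and \<psi>: "\<psi> (slope y) \<noteq> 0" and m: "mcov y \<noteq> 0"
  shows "\<psi> (slope y) * chi (slope y) + m_sq y * (\<psi> (slope y) * \<psi>2 (slope y)) \<noteq> 0"
proof
  assume 0: "\<psi> (slope y) * chi (slope y) + m_sq y * (\<psi> (slope y) * \<psi>2 (slope y)) = 0"
  let ?w = "matrix_inv A *v mcov y"
  have y0: "y \<noteq> 0" using y by (simp add: U_def)
  have F0: "F y \<noteq> 0" using \<psi> nrm_pos[OF y0] by (simp add: F_def)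
  have Aw: "A *v ?w = mcov y" by (simp add: matrix_inv_vector[OF invertible_A])
  have "lcov y \<bullet> ?w = 0"
    using A_inner_commute[of ?w y] inner_mcov_self[OF y0] Aw by (simp add: lcov_def inner_commute)
  then have "fund_tensor F y *v ?w = (dF y \<bullet> ?w) *\<^sub>R dF y
      + (\<psi> (slope y) * chi (slope y) + m_sq y * (\<psi> (slope y) * \<psi>2 (slope y))) *\<^sub>R mcov y"
    by (simp add: fund_tensor_F_mult[OF y] Aw m_sq_def algebra_simps)
  also have "\<dots> = fund_tensor F y *v ((dF y \<bullet> ?w / F y) *\<^sub>R y)"
    using F0 by (simp add: 0 matrix_vector_mult_scaleR fund_tensor_F_self[OF y])
  finally have "?w = (dF y \<bullet> ?w / F y) *\<^sub>R y"
    by (metis inv matrix_inv_vector(2))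
  then have "mcov y = (dF y \<bullet> ?w / F y) *\<^sub>R (A *v y)"
    using Aw by (metis matrix_vector_mult_scaleR)
  moreover from this have "(dF y \<bullet> ?w / F y) * (y \<bullet> (A *v y)) = 0"
    using inner_mcov_self[OF y0] by (metis inner_scaleR_right)
  ultimately show False using A_pos[OF y0] m by (metis less_irrefl mult_eq_0_iff scaleR_zero_left)
qed

text \<open>Replacing \<open>h\<close> by \<open>hbar\<close> in the Cartan tensor changes the coefficient of \<open>m\<^sub>i m\<^sub>j m\<^sub>k\<close> to a multiple of the
  defect.\<close>

lemma C_reducible_fibre_iff:
  assumes n: "CARD('n) \<ge> 3" and y: "y \<in> U" and inv: "invertible (fund_tensor F y)"
  shows "(\<forall>i j k. cartan F y i j k = 1 / (real CARD('n) + 1) *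
          (angular F y i j * cartan_trace F y k + angular F y k i * cartan_trace F y j
             + angular F y j k * cartan_trace F y i)) \<longleftrightarrow> mcov y = 0 \<or> defect (slope y) = 0"
proof -
  define t where "t = slope y"
  have y0: "y \<noteq> 0" using y by (simp add: U_def)
  have u: "nrm y > 0" using nrm_pos[OF y0] .
  have nz: "\<psi> t \<noteq> 0" "chi t \<noteq> 0" using chi_nonzero[OF assms] by (auto simp: t_def)
  obtain X where X: "X \<noteq> 0" "X \<bullet> lcov y = 0" "X \<bullet> b = 0"
    using exists_orthogonal_to_pair[OF n] by blast
  have Xm: "X \<bullet> mcov y = 0" and XdF: "X \<bullet> dF y = 0"
    using X by (auto simp: mcov_def dF_def inner_diff_right inner_add_right)
  have hb: "hbar y i j = fund_tensor F y $ i $ j - dF y $ i * dF y $ j" for i j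
    by (simp add: fund_tensor_F[OF y])
  have sym: "fund_tensor F y $ i $ j = fund_tensor F y $ j $ i" for i j
    by (simp add: fund_tensor_F[OF y] hbar_def hmet_sym[of y i j] algebra_simps)
  have "(\<Sum>i\<in>UNIV. \<Sum>j\<in>UNIV. hbar y i j * X $ i * X $ j) = X \<bullet> (fund_tensor F y *v X) - (X \<bullet> dF y)\<^sup>2"
  proof -
    have "(X \<bullet> dF y)\<^sup>2 = (\<Sum>i\<in>UNIV. \<Sum>j\<in>UNIV. dF y $ i * dF y $ j * X $ i * X $ j)"
      unfolding inner_vec_def power2_eq_square sum_product by (simp add: algebra_simps)
    then show ?thesis
      unfolding hb quadratic_form_sum[symmetric] by (simp add: sum_subtractf left_diff_distrib)
  qed
  also have "\<dots> = \<psi> t * chi t * (X \<bullet> (A *v X))"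
    using X Xm XdF by (simp add: fund_tensor_F_mult[OF y] inner_commute t_def inner_add_right inner_diff_right)
  finally have hX: "(\<Sum>i\<in>UNIV. \<Sum>j\<in>UNIV. hbar y i j * X $ i * X $ j) \<noteq> 0"
    using nz A_pos[OF X(1)] by simp
  define \<alpha> where "\<alpha> = (\<psi>1 t * chi t - t * \<psi> t * \<psi>2 t) / (2 * nrm y * \<psi> t * chi t)"
  define \<gamma> where "\<gamma> = \<psi> t * defect t / (2 * nrm y * chi t)"
  have C: "cartan F y i j k = \<alpha> * (hbar y i j * mcov y $ k + hbar y j k * mcov y $ i + hbar y k i * mcov y $ j)
      + \<gamma> * mcov y $ i * mcov y $ j * mcov y $ k" for i j k
  proof -
    define m1 m2 m3 h1 h2 h3 where d: "m1 = mcov y $ i" "m2 = mcov y $ j" "m3 = mcov y $ k"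
      "h1 = hmet y i j" "h2 = hmet y j k" "h3 = hmet y k i"
    have 1: "2 * nrm y * chi t * \<alpha> = (\<psi>1 t * chi t - t * \<psi> t * \<psi>2 t) / \<psi> t"
      and 2: "2 * nrm y * chi t * \<gamma> = \<psi> t * defect t"
      using u nz by (simp_all add: \<alpha>_def \<gamma>_def)
    have 3: "hbar y i j * m3 + hbar y j k * m1 + hbar y k i * m2
        = \<psi> t * (chi t * (h1 * m3 + h2 * m1 + h3 * m2) + 3 * \<psi>2 t * m1 * m2 * m3)"
      by (simp add: hbar_def d t_def algebra_simps)
    have "2 * nrm y * chi t * (\<alpha> * (hbar y i j * m3 + hbar y j k * m1 + hbar y k i * m2) + \<gamma> * m1 * m2 * m3)
      = (2 * nrm y * chi t * \<alpha>) * (hbar y i j * m3 + hbar y j k * m1 + hbar y k i * m2)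
        + (2 * nrm y * chi t * \<gamma>) * m1 * m2 * m3" by (simp add: algebra_simps)
    also have "\<dots> = (\<psi>1 t * chi t - t * \<psi> t * \<psi>2 t) * (chi t * (h1 * m3 + h2 * m1 + h3 * m2) + 3 * \<psi>2 t * m1 * m2 * m3)
        + \<psi> t * defect t * m1 * m2 * m3"
      unfolding 1 2 3 using nz by simp
    also have "\<dots> = chi t * ((\<psi>1 t * chi t - t * \<psi> t * \<psi>2 t) * (h1 * m3 + h2 * m1 + h3 * m2)
        + (3 * \<psi>1 t * \<psi>2 t + \<psi> t * \<psi>3 t) * m1 * m2 * m3)"
      by (simp add: defect_eq power2_eq_square algebra_simps)
    also have "\<dots> = chi t * (2 * nrm y * cartan F y i j k)"
      using cartan_F[OF y, of i j k] by (simp add: t_def d)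
    finally show ?thesis unfolding d using u nz by simp
  qed
  have "F y \<noteq> 0" using u nz by (simp add: F_def t_def)
  have my: "mcov y \<bullet> y = 0" using inner_mcov_self[OF y0] by (simp add: inner_commute)
  note main = semi_C_reducible_is_C_reducible_iff[OF inv sym fund_tensor_F_self[OF y] inner_dF_self[OF y]
      \<open>F y \<noteq> 0\<close> my Xm, of \<alpha> \<gamma>, folded hb, OF hX]
  have "\<gamma> = 0 \<longleftrightarrow> defect t = 0" using u nz by (simp add: \<gamma>_def)
  then show ?thesis
    using main unfolding angular_F[OF y] cartan_trace_def fund_inverse_def C t_def by blast
qed

end

section \<open>The coefficients of the change\<close>

text \<open>The number \<open>\<lambda>\<close> is \<open>(n + 1) p\<^sub>-\<^sub>1 / (2 p)\<close> plus a multiple \<open>\<mu>\<close> of \<open>\<kappa> = p p\<^sub>0\<^sub>2 - 3 q\<^sub>0 p\<^sub>-\<^sub>1\<close>. Its first part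
  makes \<open>\<alpha>\<^sub>1\<close> vanish and contributes a multiple of \<open>\<kappa>\<close> to \<open>\<alpha>\<^sub>2\<close>, so both are governed by \<open>\<kappa>\<close>.\<close>

lemma alphas_zero_iff:
  assumes p: "coef_p f l w \<noteq> 0" and \<Delta>: "exp s * coef_p f l w + msq * coef_q0 f w \<noteq> 0" and m: "msq \<noteq> 0"
  shows "alpha1 n f s l msq w = 0 \<and> alpha2 n f s l msq w = 0 \<longleftrightarrow>
    coef_p f l w * coef_p02 f w = 3 * coef_q0 f w * coef_pm1 f l w"
proof -
  define P Q0 P1 P2 N E where d: "P = coef_p f l w" "Q0 = coef_q0 f w" "P1 = coef_pm1 f l w"
    "P2 = coef_p02 f w" "N = real n + 1" "E = exp s"
  define \<kappa> where "\<kappa> = P * P2 - 3 * Q0 * P1"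
  define D where "D = E * P + msq * Q0"
  define \<mu> where "\<mu> = msq * \<kappa> / (2 * P * D)"
  have nz: "P \<noteq> 0" "D \<noteq> 0" "N \<noteq> 0" "E \<noteq> 0" "msq \<noteq> 0" using assms by (auto simp: d D_def)
  have l: "coef_lambda n f s l msq w = N * P1 / (2 * P) + \<mu>"
  proof -
    have "coef_lambda n f s l msq w = N * P1 / (2 * P)
        - 3 * E * P1 * msq * ((1 / E) * Q0 / (P * D)) / 2 + P2 * msq / (2 * (E * P + Q0 * msq))"
      by (simp add: coef_lambda_def coef_s0_def d D_def exp_minus inverse_eq_divide)
    also have "E * P + Q0 * msq = D" by (simp add: D_def mult.commute)
    also have "N * P1 / (2 * P) - 3 * E * P1 * msq * ((1 / E) * Q0 / (P * D)) / 2 + P2 * msq / (2 * D)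
       = N * P1 / (2 * P) + \<mu>"
      using nz by (simp add: \<mu>_def \<kappa>_def field_simps)
    finally show ?thesis .
  qed
  have a1: "alpha1 n f s l msq w = - (E * P / N) * \<mu>"
  proof -
    have "alpha1 n f s l msq w = E * P1 / 2 - E * P * (N * P1 / (2 * P) + \<mu>) / N"
      unfolding alpha1_def l by (simp add: d)
    then show ?thesis using nz by (simp add: field_simps)
  qed
  have a2: "alpha2 n f s l msq w = \<kappa> / (6 * P) - Q0 * \<mu> / N"
  proof -
    have "alpha2 n f s l msq w = P2 / 6 - Q0 * (N * P1 / (2 * P) + \<mu>) / N"
      unfolding alpha2_def l by (simp add: d)
    then show ?thesis using nz by (simp add: \<kappa>_def field_simps)
  qed
  have "alpha1 n f s l msq w = 0 \<and> alpha2 n f s l msq w = 0 \<longleftrightarrow> \<kappa> = 0"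
    unfolding a1 a2 using nz by (auto simp: \<mu>_def)
  then show ?thesis by (simp add: \<kappa>_def d)
qed

lemma D1_eqI:
  assumes "open D" "(u, v) \<in> D" "\<And>t. (t, v) \<in> D \<Longrightarrow> g (t, v) = h t" "(h has_real_derivative d) (at u)"
  shows "D1 g (u, v) = d"
proof -
  have "open ((\<lambda>t. (t, v)) -` D)" by (intro open_vimage assms(1) continuous_intros)
  then have "((\<lambda>t. g (t, v)) has_real_derivative d) (at u)"
    by (rule has_field_derivative_transform_within_open[OF assms(4)]) (use assms(2,3) in auto)
  then show ?thesis by (simp add: D1_def DERIV_imp_deriv)
qed

lemma D2_eqI:
  assumes "open D" "(u, v) \<in> D" "\<And>t. (u, t) \<in> D \<Longrightarrow> g (u, t) = h t" "(h has_real_derivative d) (at v)"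
  shows "D2 g (u, v) = d"
proof -
  have "open ((\<lambda>t. (u, t)) -` D)" by (intro open_vimage assms(1) continuous_intros)
  then have "((\<lambda>t. g (u, t)) has_real_derivative d) (at v)"
    by (rule has_field_derivative_transform_within_open[OF assms(4)]) (use assms(2,3) in auto)
  then show ?thesis by (simp add: D2_def DERIV_imp_deriv)
qed

lemma Ck_on_Suc_D2:
  fixes f :: "real \<times> real \<Rightarrow> real"
  assumes "Ck_on (Suc k) f D"
  obtains h where "Ck_on k h D" "\<And>u v. (u, v) \<in> D \<Longrightarrow> ((\<lambda>t. f (u, t)) has_real_derivative h (u, v)) (at v)"
proof
  let ?h = "\<lambda>x. frechet_derivative f (at x) (0, 1)"
  show "Ck_on k ?h D" using assms by simp
  fix u v assume uv: "(u, v) \<in> D"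
  then have d: "f differentiable at (u, v)" using assms by simp
  then have F: "(f has_derivative frechet_derivative f (at (u, v))) (at (u, v))"
    using frechet_derivative_works by blast
  have "((\<lambda>t. f (u, t)) has_derivative (\<lambda>t. frechet_derivative f (at (u, v)) (0, t))) (at v)"
    by (rule has_derivative_compose[of "\<lambda>t. (u, t)" "\<lambda>t. (0, t)" v UNIV f, OF _ F])
       (auto intro!: derivative_eq_intros)
  moreover have "(\<lambda>t. frechet_derivative f (at (u, v)) (0, t)) = (*) (?h (u, v))"
  proof
    fix t
    show "frechet_derivative f (at (u, v)) (0, t) = ?h (u, v) * t"
      using linear_scale[OF linear_frechet_derivative[OF d], of t "(0, 1)"] by (simp add: mult.commute)
  qed
  ultimately show "((\<lambda>t. f (u, t)) has_real_derivative ?h (u, v)) (at v)"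
    by (simp only: has_field_derivative_def)
qed

lemma homogeneous_profile_derivs:
  fixes f :: "real \<times> real \<Rightarrow> real"
  assumes "smooth_on D f"
  obtains p1 p2 p3 where
    "\<And>t. (1, t) \<in> D \<Longrightarrow> ((\<lambda>t. f (1, t)) has_real_derivative p1 t) (at t)"
    "\<And>t. (1, t) \<in> D \<Longrightarrow> (p1 has_real_derivative p2 t) (at t)"
    "\<And>t. (1, t) \<in> D \<Longrightarrow> (p2 has_real_derivative p3 t) (at t)"
proof -
  have "Ck_on (Suc (Suc (Suc 0))) f D" using assms by (simp only: smooth_on_def)
  from Ck_on_Suc_D2[OF this] obtain h1 where h1: "Ck_on (Suc (Suc 0)) h1 D"
    "\<And>u v. (u, v) \<in> D \<Longrightarrow> ((\<lambda>t. f (u, t)) has_real_derivative h1 (u, v)) (at v)" by metis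
  from Ck_on_Suc_D2[OF h1(1)] obtain h2 where h2: "Ck_on (Suc 0) h2 D"
    "\<And>u v. (u, v) \<in> D \<Longrightarrow> ((\<lambda>t. h1 (u, t)) has_real_derivative h2 (u, v)) (at v)" by metis
  from Ck_on_Suc_D2[OF h2(1)] obtain h3 where h3:
    "\<And>u v. (u, v) \<in> D \<Longrightarrow> ((\<lambda>t. h2 (u, t)) has_real_derivative h3 (u, v)) (at v)" by metis
  show ?thesis
    by (rule that[of "\<lambda>t. h1 (1, t)" "\<lambda>t. h2 (1, t)" "\<lambda>t. h3 (1, t)"]) (auto intro: h1 h2 h3)
qed

text \<open>The functions \<open>\<psi>1\<close>, \<open>\<psi>2\<close>, \<open>\<psi>3\<close> are the derivatives of the profile; smoothness of \<open>f\<close> provides them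
  (\<open>homogeneous_profile_derivs\<close>).\<close>

locale homogeneous_change =
  fixes D :: "(real \<times> real) set" and f :: "real \<times> real \<Rightarrow> real" and \<psi>1 \<psi>2 \<psi>3 :: "real \<Rightarrow> real"
  assumes change: "change_function D f"
    and d0: "(1, t) \<in> D \<Longrightarrow> ((\<lambda>t. f (1, t)) has_real_derivative \<psi>1 t) (at t)"
    and d1: "(1, t) \<in> D \<Longrightarrow> (\<psi>1 has_real_derivative \<psi>2 t) (at t)"
    and d2: "(1, t) \<in> D \<Longrightarrow> (\<psi>2 has_real_derivative \<psi>3 t) (at t)"
begin

definition \<psi> :: "real \<Rightarrow> real" where "\<psi> t = f (1, t)"
definition I :: "real set" where "I = {t. (1, t) \<in> D}"

lemma open_D: "open D" using change by (simp add: change_function_def)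

lemma first_pos: "(u, v) \<in> D \<Longrightarrow> 0 < u" using change by (auto simp: change_function_def)

lemma D_scale: "(u, v) \<in> D \<Longrightarrow> 0 < t \<Longrightarrow> (t * u, t * v) \<in> D \<and> f (t * u, t * v) = t * f (u, v)"
  using change by (auto simp: change_function_def)

lemma in_D_iff: "0 < u \<Longrightarrow> (u, v) \<in> D \<longleftrightarrow> v / u \<in> I"
  using D_scale[of u v "1 / u"] D_scale[of 1 "v / u" u] by (auto simp: I_def)

lemma f_eq: "(u, v) \<in> D \<Longrightarrow> f (u, v) = u * \<psi> (v / u)"
  using D_scale[of 1 "v / u" u] in_D_iff[of u v] first_pos[of u v] by (auto simp: I_def \<psi>_def)

lemma open_I: "open I"
proof -
  have "open ((\<lambda>t. (1, t)) -` D)" by (intro open_vimage open_D continuous_intros)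
  then show ?thesis by (simp add: I_def vimage_def)
qed

text \<open>A connected cone in the half plane is the cone over an interval of slopes.\<close>

lemma convex_I: "convex I"
proof -
  have "I = (\<lambda>z. snd z / fst z) ` D"
  proof (intro set_eqI iffI)
    fix t assume "t \<in> I"
    then show "t \<in> (\<lambda>z. snd z / fst z) ` D" by (auto simp: I_def intro!: image_eqI[of _ _ "(1, t)"])
  next
    fix t assume "t \<in> (\<lambda>z. snd z / fst z) ` D"
    then obtain u v where "(u, v) \<in> D" "t = v / u" by auto
    then show "t \<in> I" using in_D_iff[OF first_pos, of u v v] by simp
  qed
  moreover have "connected ((\<lambda>z. snd z / fst z) ` D)"
  proof (rule connected_continuous_image)
    show "continuous_on D (\<lambda>z. snd z / fst z)" using first_pos by (intro continuous_intros) fastforce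
    show "connected D" using change by (simp add: change_function_def)
  qed
  ultimately show ?thesis by (simp add: is_interval_connected_1[symmetric] is_interval_convex_1[symmetric])
qed

lemma deriv_\<psi>:
  assumes "t \<in> I"
  shows "(\<psi> has_real_derivative \<psi>1 t) (at t)" "(\<psi>1 has_real_derivative \<psi>2 t) (at t)"
    "(\<psi>2 has_real_derivative \<psi>3 t) (at t)"
  using assms d0[of t] d1[of t] d2[of t] by (simp_all add: I_def \<psi>_def[abs_def])

lemma partials:
  assumes D: "(u, v) \<in> D"
  defines "t \<equiv> v / u"
  shows "D1 f (u, v) = \<psi> t - t * \<psi>1 t" "D2 f (u, v) = \<psi>1 t" "D2 (D2 f) (u, v) = \<psi>2 t / u"
    "D2 (D1 f) (u, v) = - t * \<psi>2 t / u" "coef_p02 f (u, v) = (3 * \<psi>1 t * \<psi>2 t + \<psi> t * \<psi>3 t) / u"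
proof -
  have quot: "((\<lambda>s. \<phi> (s / u)) has_real_derivative d * (1 / u)) (at v)"
    if "(\<phi> has_real_derivative d) (at (v / u))" "(u, v) \<in> D" for \<phi> d u v
  proof (rule DERIV_chain2[where f = \<phi> and g = "\<lambda>s. s / u" and x = v, OF that(1)])
    show "((\<lambda>s. s / u) has_real_derivative 1 / u) (at v)"
      using first_pos[OF that(2)] by (auto intro!: derivative_eq_intros)
  qed
  have I: "v / u \<in> I" if "(u, v) \<in> D" for u v using that in_D_iff first_pos by blast
  have 1: "D1 f (u, v) = \<psi> (v / u) - (v / u) * \<psi>1 (v / u)" if D: "(u, v) \<in> D" for u v
  proof (rule D1_eqI[where g = f and h = "\<lambda>s. s * \<psi> (v / s)", OF open_D D f_eq])
    have u: "u > 0" using first_pos[OF D] .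
    have "((\<lambda>s. \<psi> (v / s)) has_real_derivative \<psi>1 (v / u) * (- v / u\<^sup>2)) (at u)"
      using u by (intro DERIV_chain2[where f = \<psi> and g = "\<lambda>s. v / s" and x = u, OF deriv_\<psi>(1)[OF I[OF D]]])
        (auto intro!: derivative_eq_intros simp: power2_eq_square)
    from DERIV_mult[OF DERIV_ident this]
    show "((\<lambda>s. s * \<psi> (v / s)) has_real_derivative \<psi> (v / u) - (v / u) * \<psi>1 (v / u)) (at u)"
      using u by (simp add: power2_eq_square mult.commute)
  qed auto
  have 2: "D2 f (u, v) = \<psi>1 (v / u)" if D: "(u, v) \<in> D" for u v
    using DERIV_cmult[OF quot[OF deriv_\<psi>(1)[OF I[OF D]] D], of u] first_pos[OF D]
    by (intro D2_eqI[where g = f and h = "\<lambda>s. u * \<psi> (s / u)", OF open_D D f_eq]) auto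
  have 3: "D2 (D2 f) (u, v) = \<psi>2 (v / u) / u" if D: "(u, v) \<in> D" for u v
    using quot[OF deriv_\<psi>(2)[OF I[OF D]] D] by (intro D2_eqI[where g = "D2 f" and h = "\<lambda>s. \<psi>1 (s / u)", OF open_D D 2]) auto
  show "D1 f (u, v) = \<psi> t - t * \<psi>1 t" "D2 f (u, v) = \<psi>1 t" "D2 (D2 f) (u, v) = \<psi>2 t / u"
    using 1[OF D] 2[OF D] 3[OF D] by (simp_all add: t_def)
  have "((\<lambda>s. \<psi> s - s * \<psi>1 s) has_real_derivative - t * \<psi>2 t) (at (v / u))"
    unfolding t_def by (auto intro!: derivative_eq_intros deriv_\<psi>[OF I[OF D]])
  from quot[OF this D] show "D2 (D1 f) (u, v) = - t * \<psi>2 t / u"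
    by (intro D2_eqI[where g = "D1 f" and h = "\<lambda>s. \<psi> (s / u) - s / u * \<psi>1 (s / u)", OF open_D D 1]) auto
  have p0: "coef_p0 f (u, v) = (\<psi>1 (v / u))\<^sup>2 + \<psi> (v / u) * \<psi>2 (v / u)" if D: "(u, v) \<in> D" for u v
    using first_pos[OF D] by (simp add: coef_p0_def coef_q0_def 2[OF D] 3[OF D] f_eq[OF D])
  have "((\<lambda>s. (\<psi>1 s)\<^sup>2 + \<psi> s * \<psi>2 s) has_real_derivative 3 * \<psi>1 t * \<psi>2 t + \<psi> t * \<psi>3 t) (at (v / u))"
    unfolding t_def by (auto intro!: derivative_eq_intros deriv_\<psi>[OF I[OF D]])
  from quot[OF this D] show "coef_p02 f (u, v) = (3 * \<psi>1 t * \<psi>2 t + \<psi> t * \<psi>3 t) / u"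
    unfolding coef_p02_def by (intro D2_eqI[where g = "coef_p0 f" and h = "\<lambda>s. (\<psi>1 (s / u))\<^sup>2 + \<psi> (s / u) * \<psi>2 (s / u)", OF open_D D p0]) auto
qed

end

section \<open>The differential equation for the profile\<close>

lemma constant_on_if_deriv_zero:
  fixes g :: "real \<Rightarrow> real"
  assumes "convex J" "\<And>t. t \<in> J \<Longrightarrow> (g has_real_derivative 0) (at t)"
  shows "\<exists>c. \<forall>t\<in>J. g t = c"
  using has_field_derivative_zero_constant[OF assms(1), of g] assms(2)
  by (auto intro: has_field_derivative_at_within)

text \<open>Up to the constant \<open>k\<close>, the second derivative of \<open>\<surd>(k t\<^sup>2 + c)\<close>.\<close>

lemma deriv_linear_over_root:
  fixes k c t :: real
  assumes "0 < k * t\<^sup>2 + c"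
  shows "((\<lambda>t. k * t / sqrt (k * t\<^sup>2 + c)) has_real_derivative k * c / sqrt (k * t\<^sup>2 + c) ^ 3) (at t)"
proof -
  define r where "r t = sqrt (k * t\<^sup>2 + c)" for t
  have r: "r t > 0" "(r t)\<^sup>2 = k * t\<^sup>2 + c" using assms by (simp_all add: r_def)
  have dr: "(r has_real_derivative k * t / r t) (at t)"
    unfolding r_def[abs_def] using assms by (auto intro!: derivative_eq_intros simp: field_simps)
  have "(k * r t - k * t * (k * t / r t)) / (r t * r t) = k * ((r t)\<^sup>2 - k * t\<^sup>2) / r t ^ 3"
    using r(1) by (simp add: power2_eq_square power3_eq_cube field_simps)
  then have "(k * r t - k * t * (k * t / r t)) / (r t * r t) = k * c / r t ^ 3" by (simp add: r(2))
  then have "((\<lambda>t. k * t / r t) has_real_derivative k * c / r t ^ 3) (at t)"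
    using r(1) by (auto intro!: derivative_eq_intros dr)
  then show ?thesis by (simp add: r_def)
qed

text \<open>Two first integrals, \<open>\<psi>'' / \<chi>\<^sup>3 = k\<close> and \<open>1 / \<chi>\<^sup>2 - k t\<^sup>2 = c\<close>, determine \<open>\<chi>\<close> up to a constant sign and
  hence \<open>\<psi>''\<close>. A third integration gives \<open>\<psi>'\<close>, and then \<open>\<psi> = \<chi> + t \<psi>'\<close> is known. Affine profiles are the
  case \<open>k = 0\<close> and appear as roots of constants.\<close>

lemma randers_or_kropina_if_ode:
  fixes \<psi> \<psi>1 \<psi>2 \<psi>3 :: "real \<Rightarrow> real"
  assumes J: "convex J"
    and d0: "\<And>t. t \<in> J \<Longrightarrow> (\<psi> has_real_derivative \<psi>1 t) (at t)"
    and d1: "\<And>t. t \<in> J \<Longrightarrow> (\<psi>1 has_real_derivative \<psi>2 t) (at t)"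
    and d2: "\<And>t. t \<in> J \<Longrightarrow> (\<psi>2 has_real_derivative \<psi>3 t) (at t)"
    and chi: "\<And>t. t \<in> J \<Longrightarrow> \<psi> t - t * \<psi>1 t \<noteq> 0"
    and ode: "\<And>t. t \<in> J \<Longrightarrow> (\<psi> t - t * \<psi>1 t) * \<psi>3 t + 3 * t * (\<psi>2 t)\<^sup>2 = 0"
  shows "(\<exists>a k c d. a \<noteq> 0 \<and> c \<noteq> 0 \<and> (\<forall>t\<in>J. 0 < k * t\<^sup>2 + c \<and> \<psi> t = a * sqrt (k * t\<^sup>2 + c) + d * t)) \<or>
         (\<exists>a d. a \<noteq> 0 \<and> (\<forall>t\<in>J. t \<noteq> 0 \<and> \<psi> t = a / t + d * t))"
proof (cases "J = {}")
  case True
  then show ?thesis by (auto intro: exI[of _ 1])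
next
  case False
  then obtain t0 where t0: "t0 \<in> J" by blast
  define X where "X t = \<psi> t - t * \<psi>1 t" for t
  have nz: "X t \<noteq> 0" if "t \<in> J" for t using chi that by (simp add: X_def)
  have dX: "(X has_real_derivative - t * \<psi>2 t) (at t)" if "t \<in> J" for t
    unfolding X_def[abs_def] using that by (auto intro!: derivative_eq_intros d0 d1)
  have "((\<lambda>t. \<psi>2 t / X t ^ 3) has_real_derivative 0) (at t)" if t: "t \<in> J" for t
  proof -
    have "\<psi>3 t * X t = - 3 * t * (\<psi>2 t)\<^sup>2" using ode[OF t] by (simp add: X_def algebra_simps)
    then have *: "X t * (\<psi>3 t * X t) = X t * (- 3 * t * (\<psi>2 t)\<^sup>2)" by simp
    have "((\<lambda>t. \<psi>2 t / X t ^ 3) has_real_derivative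
        (\<psi>3 t * X t ^ 3 - \<psi>2 t * (3 * (X t)\<^sup>2 * (- t * \<psi>2 t))) / (X t ^ 3 * X t ^ 3)) (at t)"
      using nz[OF t] by (auto intro!: derivative_eq_intros dX[OF t] d2[OF t])
    moreover have "\<psi>3 t * X t ^ 3 - \<psi>2 t * (3 * (X t)\<^sup>2 * (- t * \<psi>2 t)) = 0"
      using * by (simp add: power2_eq_square power3_eq_cube algebra_simps)
    ultimately show ?thesis by simp
  qed
  from constant_on_if_deriv_zero[OF J this]
  obtain k where "\<forall>t\<in>J. \<psi>2 t / X t ^ 3 = k" by blast
  then have k: "\<psi>2 t = k * X t ^ 3" if "t \<in> J" for t
    using nz[OF that] that by (auto simp: divide_eq_eq)
  have "((\<lambda>t. 1 / (X t)\<^sup>2 - k * t\<^sup>2) has_real_derivative 0) (at t)" if t: "t \<in> J" for t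
  proof -
    have "((\<lambda>t. 1 / (X t)\<^sup>2 - k * t\<^sup>2) has_real_derivative
        - (2 * X t * (- t * \<psi>2 t)) / ((X t)\<^sup>2 * (X t)\<^sup>2) - k * (2 * t)) (at t)"
      using nz[OF t] by (auto intro!: derivative_eq_intros dX[OF t])
    moreover have "- (2 * X t * (- t * \<psi>2 t)) / ((X t)\<^sup>2 * (X t)\<^sup>2) = k * (2 * t)"
      using nz[OF t] by (simp add: k[OF t] power2_eq_square power3_eq_cube)
    ultimately show ?thesis by simp
  qed
  from constant_on_if_deriv_zero[OF J this]
  obtain c where "\<forall>t\<in>J. 1 / (X t)\<^sup>2 - k * t\<^sup>2 = c" by blast
  then have q: "k * t\<^sup>2 + c = 1 / (X t)\<^sup>2" if "t \<in> J" for t using that by force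
  have q_pos: "0 < k * t\<^sup>2 + c" if "t \<in> J" for t using nz[OF that] by (simp add: q[OF that])
  have qX: "(k * t\<^sup>2 + c) * (X t)\<^sup>2 = 1" if "t \<in> J" for t using nz[OF that] by (simp add: q[OF that])
  show ?thesis
  proof (cases "c = 0")
    case False
    define r where "r t = sqrt (k * t\<^sup>2 + c)" for t
    have r: "r t > 0" "(r t)\<^sup>2 = k * t\<^sup>2 + c" if "t \<in> J" for t using q_pos[OF that] by (simp_all add: r_def)
    have dr: "(r has_real_derivative k * t / r t) (at t)" if t: "t \<in> J" for t
      unfolding r_def[abs_def] using q_pos[OF t] by (auto intro!: derivative_eq_intros simp: field_simps)
    (* X r has square 1; a vanishing derivative shows that its sign does not depend on t. *)
    have "((\<lambda>t. X t * r t) has_real_derivative 0) (at t)" if t: "t \<in> J" for t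
    proof -
      have 0: "k * t * X t * (1 - (r t)\<^sup>2 * (X t)\<^sup>2) = 0" using qX[OF t] by (simp add: r[OF t])
      have "- t * \<psi>2 t * r t + k * t / r t * X t = k * t * X t * (1 - (r t)\<^sup>2 * (X t)\<^sup>2) / r t"
        using r(1)[OF t] by (simp add: k[OF t] power2_eq_square power3_eq_cube field_simps)
      then have "- t * \<psi>2 t * r t + k * t / r t * X t = 0" unfolding 0 by simp
      then show ?thesis using DERIV_mult[OF dX[OF t] dr[OF t]] by simp
    qed
    from constant_on_if_deriv_zero[OF J this]
    obtain \<epsilon> where "\<forall>t\<in>J. X t * r t = \<epsilon>" by blast
    then have \<epsilon>: "X t = \<epsilon> / r t" if "t \<in> J" for t using r(1)[OF that] that by (auto simp: field_simps)
    have \<epsilon>2: "\<epsilon> * \<epsilon> = 1"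
    proof -
      have "(r t0)\<^sup>2 * (\<epsilon> / r t0)\<^sup>2 = 1" using qX[OF t0] by (simp only: r[OF t0] \<epsilon>[OF t0])
      then show ?thesis using r(1)[OF t0] by (simp add: power2_eq_square)
    qed
    then have \<epsilon>3: "\<epsilon> ^ 3 = \<epsilon>" by (simp add: power3_eq_cube)
    have "((\<lambda>t. \<psi>1 t - \<epsilon> / c * (k * t / r t)) has_real_derivative 0) (at t)" if t: "t \<in> J" for t
    proof -
      have "\<psi>2 t = k * \<epsilon> / r t ^ 3" by (simp add: k[OF t] \<epsilon>[OF t] power_divide \<epsilon>3)
      then have "\<psi>2 t - \<epsilon> / c * (k * c / r t ^ 3) = 0" using False by simp
      then show ?thesis
        using DERIV_diff[OF d1[OF t] DERIV_cmult[OF deriv_linear_over_root[OF q_pos[OF t], folded r_def], of "\<epsilon> / c"]]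
        by simp
    qed
    from constant_on_if_deriv_zero[OF J this]
    obtain d where d: "\<forall>t\<in>J. \<psi>1 t - \<epsilon> / c * (k * t / r t) = d" by blast
    have "\<psi> t = \<epsilon> / c * r t + d * t" if t: "t \<in> J" for t
    proof -
      have "\<psi>1 t = \<epsilon> / c * (k * t / r t) + d" using d t by force
      then have "\<psi> t = \<epsilon> / r t + t * (\<epsilon> / c * (k * t / r t) + d)" using \<epsilon>[OF t] by (simp add: X_def)
      also have "\<dots> = \<epsilon> / c * ((k * t\<^sup>2 + c) / r t) + d * t"
        using r(1)[OF t] False by (simp add: power2_eq_square field_simps)
      also have "(k * t\<^sup>2 + c) / r t = r t" using r[OF t] by (simp add: power2_eq_square field_simps)
      finally show ?thesis .
    qed
    moreover have "\<epsilon> / c \<noteq> 0" using \<epsilon>2 False by auto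
    ultimately show ?thesis
      using False q_pos
      by (intro disjI1 exI[of _ "\<epsilon> / c"] exI[of _ k] exI[of _ c] exI[of _ d]) (simp add: r_def)
  next
    case True
    have t: "t \<noteq> 0" if "t \<in> J" for t using q_pos[OF that] True by auto
    have "((\<lambda>t. X t * t) has_real_derivative 0) (at t)" if t: "t \<in> J" for t
    proof -
      have 0: "X t * (1 - k * t\<^sup>2 * (X t)\<^sup>2) = 0" using qX[OF t] True by simp
      have "- t * \<psi>2 t * t + 1 * X t = X t * (1 - k * t\<^sup>2 * (X t)\<^sup>2)"
        by (simp add: k[OF t] power2_eq_square power3_eq_cube algebra_simps)
      then have "- t * \<psi>2 t * t + 1 * X t = 0" unfolding 0 .
      then show ?thesis using DERIV_mult[OF dX[OF t] DERIV_ident] by simp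
    qed
    from constant_on_if_deriv_zero[OF J this]
    obtain d where "\<forall>t\<in>J. X t * t = d" by blast
    then have d: "X t = d / t" if "t \<in> J" for t using t[OF that] that by (auto simp: field_simps)
    have "d \<noteq> 0" using nz[OF t0] d[OF t0] by auto
    have \<psi>2: "\<psi>2 t = d / t ^ 3" if "t \<in> J" for t
    proof -
      have "\<psi>2 t = k * (X t)\<^sup>2 * X t" by (simp add: k[OF that] power2_eq_square power3_eq_cube)
      moreover have "k * (X t)\<^sup>2 = 1 / t\<^sup>2" using qX[OF that] True t[OF that] by (simp add: field_simps)
      ultimately show ?thesis using t[OF that] by (simp add: d[OF that] power2_eq_square power3_eq_cube)
    qed
    have "((\<lambda>t. \<psi>1 t + d / (2 * t\<^sup>2)) has_real_derivative 0) (at t)" if "t \<in> J" for t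
      using t[OF that]
      by (auto intro!: derivative_eq_intros d1[OF that] simp: \<psi>2[OF that] field_simps power2_eq_square power3_eq_cube)
    from constant_on_if_deriv_zero[OF J this]
    obtain e where e: "\<forall>t\<in>J. \<psi>1 t + d / (2 * t\<^sup>2) = e" by blast
    have "\<psi> t = (d / 2) / t + e * t" if "t \<in> J" for t
    proof -
      have "\<psi>1 t = e - d / (2 * t\<^sup>2)" using e that by force
      then have "\<psi> t = d / t + t * (e - d / (2 * t\<^sup>2))" using d[OF that] by (simp add: X_def)
      also have "t * (e - d / (2 * t\<^sup>2)) = e * t - (d / 2) / t"
        using t[OF that] by (simp add: field_simps power2_eq_square)
      finally show ?thesis by simp
    qed
    then show ?thesis using t \<open>d \<noteq> 0\<close> by (intro disjI2 exI[of _ "d / 2"] exI[of _ e]) auto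
  qed
qed

lemma derivs_eq_on_open:
  fixes g h :: "real \<Rightarrow> real"
  assumes "open J" "t \<in> J" "\<And>s. s \<in> J \<Longrightarrow> g s = h s"
    and "(g has_real_derivative a) (at t)" "(h has_real_derivative c) (at t)"
  shows "a = c"
proof -
  have "(g has_real_derivative c) (at t)"
    using has_field_derivative_transform_within_open[OF assms(5,1,2)] assms(3) by simp
  then show ?thesis using assms(4) DERIV_unique by blast
qed

text \<open>Differentiating the explicit profile on an open set. The definition of Randers type only says that the
  radicand is nonnegative; on an open set of slopes it is positive, because at a zero it would have a
  minimum, whose vanishing derivative \<open>2 k t\<close> leaves the value \<open>c \<noteq> 0\<close>.\<close>

lemma ode_if_randers_or_kropina:
  fixes \<psi> \<psi>1 \<psi>2 \<psi>3 :: "real \<Rightarrow> real"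
  assumes J: "open J"
    and d0: "\<And>t. t \<in> J \<Longrightarrow> (\<psi> has_real_derivative \<psi>1 t) (at t)"
    and d1: "\<And>t. t \<in> J \<Longrightarrow> (\<psi>1 has_real_derivative \<psi>2 t) (at t)"
    and d2: "\<And>t. t \<in> J \<Longrightarrow> (\<psi>2 has_real_derivative \<psi>3 t) (at t)"
    and type: "(\<exists>c1 c2. \<forall>t\<in>J. \<psi> t = c2 + c1 * t) \<or>
      (\<exists>a k c d. c \<noteq> 0 \<and> (\<forall>t\<in>J. 0 \<le> k * t\<^sup>2 + c \<and> \<psi> t = a * sqrt (k * t\<^sup>2 + c) + d * t)) \<or>
         (\<exists>a d. (\<forall>t\<in>J. t \<noteq> 0 \<and> \<psi> t = a / t + d * t))"
    and t: "t \<in> J"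
  shows "(\<psi> t - t * \<psi>1 t) * \<psi>3 t + 3 * t * (\<psi>2 t)\<^sup>2 = 0"
proof -
  have *: "\<psi>1 s = g1 s \<and> \<psi>2 s = g2 s \<and> \<psi>3 s = g3 s"
    if g: "\<And>s. s \<in> J \<Longrightarrow> \<psi> s = g s" "\<And>s. s \<in> J \<Longrightarrow> (g has_real_derivative g1 s) (at s)"
      "\<And>s. s \<in> J \<Longrightarrow> (g1 has_real_derivative g2 s) (at s)" "\<And>s. s \<in> J \<Longrightarrow> (g2 has_real_derivative g3 s) (at s)"
      and s: "s \<in> J" for g g1 g2 g3 s
  proof -
    have 1: "\<psi>1 s = g1 s" if "s \<in> J" for s
      using derivs_eq_on_open[OF J that, of \<psi> g] g(1,2) d0 that by blast
    have 2: "\<psi>2 s = g2 s" if "s \<in> J" for s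
      using derivs_eq_on_open[OF J that, of \<psi>1 g1] g(3) 1 d1 that by blast
    have "\<psi>3 s = g3 s" using derivs_eq_on_open[OF J s, of \<psi>2 g2] g(4) 2 d2 s by blast
    then show ?thesis using 1 2 s by blast
  qed
  from type show ?thesis
  proof (elim disjE exE conjE)
    fix c1 c2 assume linear: "\<forall>t\<in>J. \<psi> t = c2 + c1 * t"
    have 0: "((\<lambda>t. c2 + c1 * t) has_real_derivative c1) (at s)" for s
      by (auto intro!: derivative_eq_intros)
    have "\<psi>1 t = c1 \<and> \<psi>2 t = 0 \<and> \<psi>3 t = 0"
    proof (rule *[OF _ _ _ _ t])
      show "\<psi> s = c2 + c1 * s" if "s \<in> J" for s using linear that by blast
    qed (rule 0 DERIV_const)+
    then show ?thesis by simp
  next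
    fix a k c d
    assume root: "c \<noteq> 0" "\<forall>t\<in>J. 0 \<le> k * t\<^sup>2 + c \<and> \<psi> t = a * sqrt (k * t\<^sup>2 + c) + d * t"
    have pos: "0 < k * s\<^sup>2 + c" if s: "s \<in> J" for s
    proof (rule ccontr)
      assume "\<not> 0 < k * s\<^sup>2 + c"
      then have 0: "k * s\<^sup>2 + c = 0" using root(2) s by force
      obtain e where e: "e > 0" "ball s e \<subseteq> J" using J s open_contains_ball by blast
      have "((\<lambda>s. k * s\<^sup>2 + c) has_real_derivative 2 * k * s) (at s)"
        by (auto intro!: derivative_eq_intros)
      then have "2 * k * s = 0"
      proof (rule DERIV_local_min[OF _ e(1)])
        show "\<forall>y. \<bar>s - y\<bar> < e \<longrightarrow> k * s\<^sup>2 + c \<le> k * y\<^sup>2 + c"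
          unfolding 0 using e(2) root(2) by (auto simp: dist_real_def subset_iff)
      qed
      then have "k * s\<^sup>2 = 0" by (auto simp: power2_eq_square)
      then show False using 0 root(1) by auto
    qed
    define r where "r t = sqrt (k * t\<^sup>2 + c)" for t
    have r: "r t > 0" "(r t)\<^sup>2 = k * t\<^sup>2 + c" if "t \<in> J" for t using pos[OF that] by (simp_all add: r_def)
    have dr: "(r has_real_derivative k * t / r t) (at t)" if t: "t \<in> J" for t
      unfolding r_def[abs_def] using pos[OF t] by (auto intro!: derivative_eq_intros simp: field_simps)
    have 1: "((\<lambda>t. a * (k * t / r t) + d) has_real_derivative a * k * c / r t ^ 3) (at t)" if t: "t \<in> J" for t
      using DERIV_add[OF DERIV_cmult[OF deriv_linear_over_root[OF pos[OF t], folded r_def], of a] DERIV_const[of d]]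
      by (simp only: mult.assoc add_0_right times_divide_eq_right[symmetric])
    have 2: "((\<lambda>t. a * k * c / r t ^ 3) has_real_derivative - 3 * a * k\<^sup>2 * c * t / r t ^ 5) (at t)" if t: "t \<in> J" for t
      using r(1)[OF t]
      by (auto intro!: derivative_eq_intros dr[OF t] simp: field_simps power2_eq_square eval_nat_numeral)
    have 0: "((\<lambda>t. a * r t + d * t) has_real_derivative a * (k * t / r t) + d) (at t)" if "t \<in> J" for t
      by (auto intro!: derivative_eq_intros dr[OF that])
    have eq: "\<psi>1 t = a * (k * t / r t) + d \<and> \<psi>2 t = a * k * c / r t ^ 3 \<and> \<psi>3 t = - 3 * a * k\<^sup>2 * c * t / r t ^ 5"
      by (rule *[of "\<lambda>t. a * r t + d * t"])
         (use root(2) t 0 1 2 in \<open>simp_all add: r_def[symmetric]\<close>)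
    have "\<psi> t = a * r t + d * t" using root(2) t by (simp add: r_def)
    then have "\<psi> t - t * \<psi>1 t = a * ((r t)\<^sup>2 - k * t\<^sup>2) / r t"
      using r(1)[OF t] by (simp add: eq power2_eq_square field_simps)
    then have "\<psi> t - t * \<psi>1 t = a * c / r t" by (simp add: r(2)[OF t])
    then show ?thesis
      using r(1)[OF t] by (simp add: eq) (simp add: power2_eq_square field_simps eval_nat_numeral)
  next
    fix a d
    assume quotient: "\<forall>t\<in>J. t \<noteq> 0 \<and> \<psi> t = a / t + d * t"
    have nz: "s \<noteq> 0" if "s \<in> J" for s using quotient that by blast
    have 0: "((\<lambda>t. a / t + d * t) has_real_derivative - a / s\<^sup>2 + d) (at s)" if "s \<in> J" for s
      using nz[OF that] by (auto intro!: derivative_eq_intros simp: power2_eq_square)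
    have 1: "((\<lambda>t. - a / t\<^sup>2 + d) has_real_derivative 2 * a / s ^ 3) (at s)" if "s \<in> J" for s
      using nz[OF that] by (auto intro!: derivative_eq_intros simp: power2_eq_square power3_eq_cube mult_ac)
    have 2: "((\<lambda>t. 2 * a / t ^ 3) has_real_derivative - 6 * a / s ^ 4) (at s)" if "s \<in> J" for s
      using nz[OF that] by (auto intro!: derivative_eq_intros simp: eval_nat_numeral)
    have "\<psi>1 t = - a / t\<^sup>2 + d \<and> \<psi>2 t = 2 * a / t ^ 3 \<and> \<psi>3 t = - 6 * a / t ^ 4"
      by (rule *[of "\<lambda>t. a / t + d * t"]) (use quotient t 0 1 2 in simp_all)
    then show ?thesis using quotient t nz[OF t]
      by simp (simp add: field_simps power2_eq_square eval_nat_numeral)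
  qed
qed

section \<open>Riemannian metrics on one tangent space\<close>

lemma has_vpartial_if_differentiable:
  assumes "F differentiable at y"
  shows "has_vpartial i F (frechet_derivative F (at y) (axis i 1)) y"
proof -
  let ?F' = "frechet_derivative F (at y)"
  have F: "(F has_derivative ?F') (at y)" using assms frechet_derivative_works by blast
  have "((\<lambda>t. F (y + t *\<^sub>R axis i 1)) has_derivative (\<lambda>t. ?F' (t *\<^sub>R axis i 1))) (at 0)"
  proof (rule has_derivative_compose[of _ "\<lambda>t. t *\<^sub>R axis i 1" 0 UNIV F ?F', simplified])
    show "((\<lambda>t. y + t *\<^sub>R axis i 1) has_derivative (\<lambda>t. t *\<^sub>R axis i 1)) (at 0)"
      by (auto intro!: derivative_eq_intros)
  qed (use F in simp)
  moreover have "?F' (t *\<^sub>R axis i 1) = ?F' (axis i 1) * t" for t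
    using linear_scale[OF linear_frechet_derivative[OF assms]] by simp
  ultimately show ?thesis
    unfolding has_vpartial_def has_field_derivative_def by simp
qed

lemma frechet_derivative_eq_sum_vpartial:
  fixes F :: "real ^ 'n::finite \<Rightarrow> real"
  assumes "F differentiable at y"
  shows "frechet_derivative F (at y) v = (\<Sum>i\<in>UNIV. vpartial i F y * v $ i)"
proof -
  have lin: "linear (frechet_derivative F (at y))" by (rule linear_frechet_derivative[OF assms])
  have "frechet_derivative F (at y) v = frechet_derivative F (at y) (\<Sum>i\<in>UNIV. v $ i *\<^sub>R axis i 1)"
    using basis_expansion[of v] by (simp add: scalar_mult_eq_scaleR)
  also have "\<dots> = (\<Sum>i\<in>UNIV. v $ i * frechet_derivative F (at y) (axis i 1))"
    by (simp add: linear_sum[OF lin] linear_scale[OF lin])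
  finally show ?thesis
    using vpartial_eqI[OF has_vpartial_if_differentiable[OF assms]] by (simp add: mult.commute)
qed

lemma deriv_along_ray:
  fixes F :: "real ^ 'n::finite \<Rightarrow> real"
  assumes "F differentiable at y"
  shows "((\<lambda>t. F (t *\<^sub>R y)) has_real_derivative (\<Sum>i\<in>UNIV. vpartial i F y * y $ i)) (at 1)"
proof -
  let ?F' = "frechet_derivative F (at y)"
  have F: "(F has_derivative ?F') (at (1 *\<^sub>R y))" using assms frechet_derivative_works by auto
  have "((\<lambda>t. F (t *\<^sub>R y)) has_derivative (\<lambda>t. ?F' (t *\<^sub>R y))) (at 1)"
    by (rule has_derivative_compose[of "\<lambda>t. t *\<^sub>R y" "\<lambda>t. t *\<^sub>R y" 1 UNIV F ?F', OF _ F])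
       (auto intro!: derivative_eq_intros)
  moreover have "?F' (t *\<^sub>R y) = ?F' y * t" for t
    using linear_scale[OF linear_frechet_derivative[OF assms]] by simp
  ultimately show ?thesis
    unfolding has_field_derivative_def frechet_derivative_eq_sum_vpartial[OF assms, symmetric] by simp
qed

text \<open>Let \<open>Q = N\<^sup>2\<close>. Its second partial derivatives are the constants \<open>2 g\<^sub>i\<^sub>j\<close>, its first ones are homogeneous of
  degree 1 and \<open>Q\<close> itself of degree 2. Differentiating along rays recovers first the gradient and then \<open>Q\<close>
  from the second derivatives. The gradient computed from \<open>Q(y) = y \<bullet> g y\<close> must agree with the one obtained
  before, which gives the symmetry of \<open>g\<close> without the symmetry of second derivatives.\<close>

lemma riemannian_fibre:
  fixes N :: "real ^ 'n::finite \<Rightarrow> real" and g :: "real ^ 'n ^ 'n"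
  assumes pos: "\<And>y. y \<noteq> 0 \<Longrightarrow> 0 < N y"
    and hom: "\<And>y t. y \<noteq> 0 \<Longrightarrow> 0 < t \<Longrightarrow> N (t *\<^sub>R y) = t * N y"
    and diff: "\<And>y. y \<noteq> 0 \<Longrightarrow> N differentiable at y"
    and diff2: "\<And>y i. y \<noteq> 0 \<Longrightarrow> vpartial i N differentiable at y"
    and g: "\<And>y. y \<noteq> 0 \<Longrightarrow> fund_tensor N y = g"
  shows "y \<noteq> 0 \<Longrightarrow> (N y)\<^sup>2 = y \<bullet> (g *v y)" "g $ i $ j = g $ j $ i"
proof -
  define Q where "Q y = (N y)\<^sup>2" for y
  have opn: "open (- {0 :: real ^ 'n})" by (rule open_Compl) simp
  have Q1: "has_vpartial i Q (2 * N y * vpartial i N y) y" if "y \<noteq> 0" for i y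
    using has_vpartial_if_differentiable[OF diff[OF that], of i]
      vpartial_eqI[OF has_vpartial_if_differentiable[OF diff[OF that], of i]]
    unfolding has_vpartial_def Q_def by (auto intro!: derivative_eq_intros)
  have Qdiff: "Q differentiable at y" if "y \<noteq> 0" for y
    unfolding Q_def[abs_def] using diff[OF that] by (intro differentiable_power)
  have Qidiff: "vpartial i Q differentiable at y" if "y \<noteq> 0" for i y
  proof -
    have "(\<lambda>y. 2 * N y * vpartial i N y) differentiable at y"
      by (intro differentiable_mult differentiable_const diff diff2 that)
    then obtain Q' where "((\<lambda>y. 2 * N y * vpartial i N y) has_derivative Q') (at y)"
      by (auto simp: differentiable_def)
    then have "(vpartial i Q has_derivative Q') (at y)"
      by (rule has_derivative_transform_within_open[OF _ opn]) (use that vpartial_eqI[OF Q1] in auto)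
    then show ?thesis by (auto simp: differentiable_def)
  qed
  have Qhom: "Q (t *\<^sub>R y) = t\<^sup>2 * Q y" if "y \<noteq> 0" "0 < t" for t y
    by (simp add: Q_def hom[OF that] power_mult_distrib)
  have Qihom: "vpartial i Q (t *\<^sub>R y) = t * vpartial i Q y" if y: "y \<noteq> 0" and t: "0 < t" for i t y
  proof -
    have "has_vpartial i Q (t * vpartial i Q y) (t *\<^sub>R y)"
    proof -
      have "((\<lambda>s. Q (y + s *\<^sub>R axis i 1)) has_real_derivative vpartial i Q y) (at (0 / t))"
        using has_vpartial_if_differentiable[OF Qdiff[OF y], of i]
          vpartial_eqI[OF has_vpartial_if_differentiable[OF Qdiff[OF y], of i]]
        by (simp add: has_vpartial_def)
      moreover have "((\<lambda>s. s / t) has_real_derivative 1 / t) (at 0)"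
        using t by (auto intro!: derivative_eq_intros)
      ultimately have "((\<lambda>s. Q (y + (s / t) *\<^sub>R axis i 1)) has_real_derivative vpartial i Q y * (1 / t)) (at 0)"
        by (rule DERIV_chain2)
      then have "((\<lambda>s. t\<^sup>2 * Q (y + (s / t) *\<^sub>R axis i 1)) has_real_derivative t\<^sup>2 * (vpartial i Q y * (1 / t))) (at 0)"
        by (rule DERIV_cmult)
      moreover have "eventually (\<lambda>s. t\<^sup>2 * Q (y + (s / t) *\<^sub>R axis i 1) = Q (t *\<^sub>R y + s *\<^sub>R axis i 1)) (nhds 0)"
        using eventually_line_in_open[OF opn, of y "(1 / t) *\<^sub>R axis i 1"] y
        by (auto elim!: eventually_mono simp: Qhom[OF _ t, symmetric] t scaleR_right_distrib)
          (use t in simp)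
      ultimately show ?thesis
        unfolding has_vpartial_def using t by (subst (asm) DERIV_cong_ev) (auto simp: power2_eq_square)
    qed
    then show ?thesis by (rule vpartial_eqI)
  qed
  have Qij: "vpartial i (vpartial j Q) y = 2 * g $ i $ j" if "y \<noteq> 0" for i j y
    using g[OF that] by (auto simp: fund_tensor_def Q_def[abs_def] vec_eq_iff)
  have Qi: "vpartial j Q y = 2 * (\<Sum>i\<in>UNIV. g $ i $ j * y $ i)" if y: "y \<noteq> 0" for j y
  proof -
    have "((\<lambda>t. t * vpartial j Q y) has_real_derivative (\<Sum>i\<in>UNIV. vpartial i (vpartial j Q) y * y $ i)) (at 1)"
      by (rule has_field_derivative_transform_within_open[OF deriv_along_ray[OF Qidiff[OF y]], of "{0<..}"])
         (use Qihom[OF y] in auto)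
    moreover have "((\<lambda>t. t * vpartial j Q y) has_real_derivative vpartial j Q y) (at 1)"
      by (auto intro!: derivative_eq_intros)
    ultimately have "vpartial j Q y = (\<Sum>i\<in>UNIV. vpartial i (vpartial j Q) y * y $ i)"
      using DERIV_unique by blast
    then show ?thesis by (simp add: Qij[OF y] sum_distrib_left mult.assoc)
  qed
  have Qy: "Q y = y \<bullet> (g *v y)" if y: "y \<noteq> 0" for y
  proof -
    have "((\<lambda>t. t\<^sup>2 * Q y) has_real_derivative (\<Sum>i\<in>UNIV. vpartial i Q y * y $ i)) (at 1)"
      by (rule has_field_derivative_transform_within_open[OF deriv_along_ray[OF Qdiff[OF y]], of "{0<..}"])
         (use Qhom[OF y] in auto)
    moreover have "((\<lambda>t. t\<^sup>2 * Q y) has_real_derivative 2 * Q y) (at 1)"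
      by (auto intro!: derivative_eq_intros)
    ultimately have "2 * Q y = (\<Sum>i\<in>UNIV. vpartial i Q y * y $ i)"
      using DERIV_unique by blast
    also have "\<dots> = 2 * (\<Sum>j\<in>UNIV. \<Sum>i\<in>UNIV. g $ i $ j * y $ i * y $ j)"
      by (simp add: Qi[OF y] sum_distrib_left sum_distrib_right mult.assoc)
    also have "(\<Sum>j\<in>UNIV. \<Sum>i\<in>UNIV. g $ i $ j * y $ i * y $ j) = y \<bullet> (g *v y)"
      by (subst sum.swap) (rule quadratic_form_sum)
    finally show ?thesis by simp
  qed
  show "(N y)\<^sup>2 = y \<bullet> (g *v y)" if "y \<noteq> 0" using Qy[OF that] by (simp add: Q_def)
  show "g $ i $ j = g $ j $ i"
  proof -
    let ?e = "axis i 1 :: real ^ 'n"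
    have e0: "?e \<noteq> 0" by (simp add: axis_eq_0_iff)
    have exp: "(?e + t *\<^sub>R axis j 1) \<bullet> (g *v (?e + t *\<^sub>R axis j 1)) =
      ?e \<bullet> (g *v ?e) + t * (?e \<bullet> (g *v axis j 1) + axis j 1 \<bullet> (g *v ?e)) + t\<^sup>2 * (axis j 1 \<bullet> (g *v axis j 1))" for t
      by (simp add: matrix_vector_right_distrib matrix_vector_mult_scaleR inner_add_left
        inner_add_right power2_eq_square algebra_simps)
    have "has_vpartial j (\<lambda>y. y \<bullet> (g *v y)) (?e \<bullet> (g *v axis j 1) + axis j 1 \<bullet> (g *v ?e)) ?e"
    proof -
      have "((\<lambda>t. C0 + t * C1 + t\<^sup>2 * C2) has_real_derivative C1) (at 0)" for C0 C1 C2 :: real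
        by (auto intro!: derivative_eq_intros)
      then show ?thesis unfolding has_vpartial_def exp .
    qed
    then have "has_vpartial j Q (?e \<bullet> (g *v axis j 1) + axis j 1 \<bullet> (g *v ?e)) ?e"
      by (rule has_vpartial_transform[OF _ opn]) (use e0 Qy in auto)
    then have "vpartial j Q ?e = g $ i $ j + g $ j $ i"
      by (auto dest!: vpartial_eqI simp: inner_axis' matrix_vector_mul_component inner_axis)
    moreover have "vpartial j Q ?e = 2 * g $ i $ j"
      using Qi[OF e0, of j] by (simp add: axis_def if_distrib cong: if_cong)
    ultimately show ?thesis by simp
  qed
qed

text \<open>Smoothness of a Finsler function is a condition on all of the tangent bundle; this restricts it to a
  single tangent space.\<close>

lemma slice_differentiable:
  fixes G :: "(real ^ 'n::finite) \<times> (real ^ 'n) \<Rightarrow> real"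
  assumes G: "smooth_on S G" and S: "\<And>z. z \<in> V \<Longrightarrow> (x, z) \<in> S" and V: "open V" "y \<in> V"
  shows "(\<lambda>z. G (x, z)) differentiable at y" "vpartial i (\<lambda>z. G (x, z)) differentiable at y"
proof -
  let ?H = "\<lambda>w. frechet_derivative G (at w) (0, axis i 1)"
  have C: "Ck_on (Suc (Suc 0)) G S" using G by (simp only: smooth_on_def)
  have slice: "((\<lambda>z. H (x, z)) has_derivative (\<lambda>w. frechet_derivative H (at (x, z)) (0, w))) (at z)"
    if "H differentiable at (x, z)" for H :: "(real ^ 'n) \<times> (real ^ 'n) \<Rightarrow> real" and z
    by (rule has_derivative_compose[of "\<lambda>z. (x, z)" "\<lambda>w. (0, w)"])
       (use that frechet_derivative_works in \<open>auto intro!: derivative_eq_intros\<close>)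
  have Gd: "G differentiable at (x, z)" if "z \<in> V" for z using C S[OF that] by simp
  have Hd: "?H differentiable at (x, y)" using C S[OF V(2)] by simp
  show d: "(\<lambda>z. G (x, z)) differentiable at y" using slice[OF Gd[OF V(2)]] by (auto simp: differentiable_def)
  have eq: "vpartial i (\<lambda>z. G (x, z)) z = ?H (x, z)" if "z \<in> V" for z
  proof -
    note s = slice[OF Gd[OF that]]
    have "(\<lambda>z. G (x, z)) differentiable at z" using s by (auto simp: differentiable_def)
    from vpartial_eqI[OF has_vpartial_if_differentiable[OF this]] show ?thesis
      unfolding frechet_derivative_at[OF s, symmetric] .
  qed
  have "(vpartial i (\<lambda>z. G (x, z)) has_derivative (\<lambda>w. frechet_derivative ?H (at (x, y)) (0, w))) (at y)"
    by (rule has_derivative_transform_within_open[OF slice[OF Hd] V]) (use eq in auto)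
  then show "vpartial i (\<lambda>z. G (x, z)) differentiable at y" by (auto simp: differentiable_def)
qed

section \<open>Charts and tangent vectors\<close>

lemma smooth_on_differentiable: "smooth_on S f \<Longrightarrow> x \<in> S \<Longrightarrow> f differentiable at x"
proof -
  assume "smooth_on S f" "x \<in> S"
  then have "Ck_on (Suc 0) f S" by (simp only: smooth_on_def)
  then show ?thesis using \<open>x \<in> S\<close> by simp
qed

context
  fixes X :: "'a topology" and \<A> :: "('a, 'n::finite) chart set"
  assumes M: "smooth_manifold X \<A>"
begin

lemma chart_domain: "c \<in> \<A> \<Longrightarrow> fst c \<subseteq> topspace X"
  using M unfolding smooth_manifold_def by blast

lemma chart_inj: "c \<in> \<A> \<Longrightarrow> inj_on (snd c) (fst c)"
proof -
  assume c: "c \<in> \<A>"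
  then have "homeomorphic_map (subtopology X (fst c)) (top_of_set (snd c ` fst c)) (snd c)"
    using M unfolding smooth_manifold_def by blast
  then have "inj_on (snd c) (topspace (subtopology X (fst c)))"
    by (rule homeomorphic_imp_injective_map)
  then show ?thesis using chart_domain[OF c] by (simp add: Int_absorb1)
qed

lemma chart_inv_chart: "c \<in> \<A> \<Longrightarrow> p \<in> fst c \<Longrightarrow> chart_inv c (snd c p) = p"
  using chart_inj by (simp add: inv_into_f_f)

lemma transition_differentiable:
  assumes "c \<in> \<A>" "d \<in> \<A>" "p \<in> fst c" "p \<in> fst d"
  shows "(snd d \<circ> chart_inv c) differentiable at (snd c p)"
proof -
  have "smooth_on (snd c ` (fst c \<inter> fst d)) (snd d \<circ> chart_inv c)"
    using M assms(1,2) unfolding smooth_manifold_def by blast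
  then show ?thesis by (rule smooth_on_differentiable) (use assms in blast)
qed

lemma transition_scaleR:
  assumes "c \<in> \<A>" "d \<in> \<A>" "p \<in> fst c" "p \<in> fst d"
  shows "frechet_derivative (snd d \<circ> chart_inv c) (at (snd c p)) (t *\<^sub>R y)
    = t *\<^sub>R frechet_derivative (snd d \<circ> chart_inv c) (at (snd c p)) y"
  by (rule linear_scale[OF linear_frechet_derivative[OF transition_differentiable[OF assms]]])

lemma overlap_image_open:
  assumes "c \<in> \<A>" "d \<in> \<A>"
  shows "open (snd c ` (fst c \<inter> fst d))"
proof -
  have hc: "homeomorphic_map (subtopology X (fst c)) (top_of_set (snd c ` fst c)) (snd c)"
    and oc: "open (snd c ` fst c)" "openin X (fst c)" "openin X (fst d)"
    using M assms unfolding smooth_manifold_def by blast+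
  have "openin (subtopology X (fst c)) (fst c \<inter> fst d)"
    using oc by (simp add: openin_open_subtopology openin_Int)
  then have "openin (top_of_set (snd c ` fst c)) (snd c ` (fst c \<inter> fst d))"
    using homeomorphic_imp_open_map[OF hc] unfolding open_map_def by blast
  then show ?thesis using oc(1) openin_open_trans by blast
qed

text \<open>The chain rule for coordinate changes: the component vectors that \<open>bundle_point\<close> assigns to the charts
  are consistent, so it yields tangent vectors.\<close>

lemma transition_compose:
  assumes "c \<in> \<A>" "d \<in> \<A>" "e \<in> \<A>" "p \<in> fst c" "p \<in> fst d" "p \<in> fst e"
  shows "frechet_derivative (snd e \<circ> chart_inv d) (at (snd d p))
      (frechet_derivative (snd d \<circ> chart_inv c) (at (snd c p)) y)
    = frechet_derivative (snd e \<circ> chart_inv c) (at (snd c p)) y"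
proof -
  let ?cd = "snd d \<circ> chart_inv c" and ?de = "snd e \<circ> chart_inv d" and ?ce = "snd e \<circ> chart_inv c"
  have cd: "(?cd has_derivative frechet_derivative ?cd (at (snd c p))) (at (snd c p))"
    using transition_differentiable[OF assms(1,2,4,5)] frechet_derivative_works by blast
  have eq: "?cd (snd c p) = snd d p" using chart_inv_chart[OF assms(1,4)] by simp
  have de: "(?de has_derivative frechet_derivative ?de (at (snd d p))) (at (?cd (snd c p)))"
    unfolding eq using transition_differentiable[OF assms(2,3,5,6)] frechet_derivative_works by blast
  have "((?de \<circ> ?cd) has_derivative (frechet_derivative ?de (at (snd d p)) \<circ> frechet_derivative ?cd (at (snd c p)))) (at (snd c p))"
    by (rule diff_chain_at[OF cd de])
  moreover have "open (snd c ` (fst c \<inter> fst d))" by (rule overlap_image_open[OF assms(1,2)])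
  moreover have "snd c p \<in> snd c ` (fst c \<inter> fst d)" using assms by blast
  moreover have "(?de \<circ> ?cd) x = ?ce x" if "x \<in> snd c ` (fst c \<inter> fst d)" for x
    using that chart_inv_chart[OF assms(1)] chart_inv_chart[OF assms(2)] by auto
  ultimately have "(?ce has_derivative (frechet_derivative ?de (at (snd d p)) \<circ> frechet_derivative ?cd (at (snd c p)))) (at (snd c p))"
    by (rule has_derivative_transform_within_open)
  from frechet_derivative_at[OF this] show ?thesis by (metis comp_apply)
qed

lemma transition_self:
  assumes "c \<in> \<A>" "p \<in> fst c"
  shows "frechet_derivative (snd c \<circ> chart_inv c) (at (snd c p)) y = y"
proof -
  have "((\<lambda>x. x) has_derivative (\<lambda>x. x)) (at (snd c p))" by simp
  then have "((snd c \<circ> chart_inv c) has_derivative (\<lambda>x. x)) (at (snd c p))"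
    by (rule has_derivative_transform_within_open[of _ _ _ _ "snd c ` (fst c \<inter> fst c)"])
       (use overlap_image_open[OF assms(1,1)] assms chart_inv_chart[OF assms(1)] in auto)
  from frechet_derivative_at[OF this] show ?thesis by metis
qed

lemma bundle_point_in_slit:
  assumes c: "c \<in> \<A>" and p: "p \<in> fst c" and y: "y \<noteq> 0"
  shows "bundle_point \<A> c (snd c p) y \<in> slit_tangent_bundle X \<A>"
proof -
  let ?v = "\<lambda>d. if d \<in> \<A> \<and> p \<in> fst d then frechet_derivative (snd d \<circ> chart_inv c) (at (snd c p)) y else 0"
  have eq: "bundle_point \<A> c (snd c p) y = (p, ?v)"
    unfolding bundle_point_def chart_inv_chart[OF c p] by simp
  have "?v \<in> tangent_space \<A> p"
    unfolding tangent_space_def using transition_compose[OF c] p by auto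
  moreover have "?v \<noteq> (\<lambda>_. 0)"
  proof
    assume "?v = (\<lambda>_. 0)"
    from fun_cong[OF this, of c] show False using transition_self[OF c p] c p y by simp
  qed
  ultimately show ?thesis unfolding eq slit_tangent_bundle_def using chart_domain[OF c] p by blast
qed

text \<open>Every nonzero tangent vector has coordinates in some chart, so the set of attained values can be
  studied in charts.\<close>

lemma slit_point_eq_bundle_point:
  assumes "w \<in> slit_tangent_bundle X \<A>"
  obtains c p y where "c \<in> \<A>" "p \<in> fst c" "y \<noteq> 0" "w = bundle_point \<A> c (snd c p) y"
proof -
  obtain p v where w: "w = (p, v)" "p \<in> topspace X" "v \<in> tangent_space \<A> p" "v \<noteq> (\<lambda>_. 0)"
    using assms by (auto simp: slit_tangent_bundle_def)
  obtain c where c: "c \<in> \<A>" "p \<in> fst c"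
    using M w(2) unfolding smooth_manifold_def by blast
  have v: "v d = (if d \<in> \<A> \<and> p \<in> fst d then frechet_derivative (snd d \<circ> chart_inv c) (at (snd c p)) (v c) else 0)" for d
  proof -
    have "d \<in> \<A> \<Longrightarrow> p \<in> fst d \<Longrightarrow> v d = frechet_derivative (snd d \<circ> chart_inv c) (at (snd c p)) (v c)"
      and "\<not> (d \<in> \<A> \<and> p \<in> fst d) \<Longrightarrow> v d = 0"
      using w(3) c unfolding tangent_space_def by blast+
    then show ?thesis by simp
  qed
  have "v c \<noteq> 0"
  proof
    assume 0: "v c = 0"
    have "v d = 0" for d
      using v[of d] 0 transition_scaleR[OF c(1) _ c(2), of d 0 0] by (cases "d \<in> \<A> \<and> p \<in> fst d") auto
    then show False using w(4) by blast
  qed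
  moreover have "w = bundle_point \<A> c (snd c p) (v c)"
    unfolding bundle_point_def chart_inv_chart[OF c] using v by (simp add: w(1) fun_eq_iff)
  ultimately show ?thesis using that c by blast
qed

text \<open>A Riemannian metric is thus available on every full punctured tangent space, which is what makes all
  slopes up to \<open>|b|\<close> occur.\<close>

lemma coord_set_slit:
  assumes "c \<in> \<A>"
  shows "coord_set \<A> c (slit_tangent_bundle X \<A>) = (snd c ` fst c) \<times> (- {0})"
proof -
  have "y \<noteq> 0" if "bundle_point \<A> c (snd c p) y \<in> slit_tangent_bundle X \<A>" "p \<in> fst c" for p y
  proof
    assume "y = 0"
    have "snd (bundle_point \<A> c (snd c p) y) d = 0" for d
    proof (cases "d \<in> \<A> \<and> p \<in> fst d")
      case True
      then show ?thesis
        using transition_scaleR[OF assms _ that(2), of d 0 0] \<open>y = 0\<close>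
        unfolding bundle_point_def chart_inv_chart[OF assms that(2)] by simp
    next
      case False
      then show ?thesis unfolding bundle_point_def chart_inv_chart[OF assms that(2)] by auto
    qed
    then have "snd (bundle_point \<A> c (snd c p) y) = (\<lambda>_. 0)" by blast
    then show False using that(1) by (auto simp: slit_tangent_bundle_def)
  qed
  then show ?thesis using bundle_point_in_slit[OF assms] by (auto simp: coord_set_def)
qed

lemma bundle_point_scaleR:
  assumes "c \<in> \<A>" "p \<in> fst c"
  shows "bundle_point \<A> c (snd c p) (t *\<^sub>R y) =
    (fst (bundle_point \<A> c (snd c p) y), \<lambda>d. t *\<^sub>R snd (bundle_point \<A> c (snd c p) y) d)"
  unfolding bundle_point_def chart_inv_chart[OF assms]
  by (simp only: fst_conv snd_conv prod.inject simp_thms, rule ext)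
    (simp add: transition_scaleR[OF assms(1) _ assms(2)])

end

section \<open>Values of the slope\<close>

lemma closure_nonneg:
  fixes g :: "real \<Rightarrow> real"
  assumes "t \<in> closure J" "isCont g t" "\<And>s. s \<in> J \<Longrightarrow> 0 \<le> g s"
  shows "0 \<le> g t"
proof -
  obtain s where s: "\<And>n. s n \<in> J" "s \<longlonglongrightarrow> t" using assms(1) closure_sequential by blast
  have "(\<lambda>n. g (s n)) \<longlonglongrightarrow> g t" using isCont_tendsto_compose[OF assms(2) s(2)] .
  then show ?thesis by (rule LIMSEQ_le_const) (use assms(3) s(1) in auto)
qed

lemma closure_eq:
  fixes g h :: "real \<Rightarrow> real"
  assumes "t \<in> closure J" "isCont g t" "isCont h t" "\<And>s. s \<in> J \<Longrightarrow> g s = h s"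
  shows "g t = h t"
  using closure_nonneg[OF assms(1), of "\<lambda>s. g s - h s"] closure_nonneg[OF assms(1), of "\<lambda>s. h s - g s"] assms
  by (simp add: continuous_diff)

text \<open>A slope on the boundary of the ball of radius \<open>r\<close> can be moved slightly towards 0 without leaving the
  open set \<open>I\<close>.\<close>

lemma closed_radius_in_closure:
  fixes I R :: "real set"
  assumes "open I" "t \<in> I" "r \<in> R" "\<bar>t\<bar> \<le> r" "0 < r"
  shows "t \<in> closure {s \<in> I. \<exists>r\<in>R. \<bar>s\<bar> < r}"
  unfolding closure_approachable
proof (intro allI impI)
  fix e :: real assume e: "0 < e"
  obtain d where d: "d > 0" "ball t d \<subseteq> I" using assms(1,2) open_contains_ball by blast
  define \<delta> where "\<delta> = Min {e, d, r} / 2"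
  have \<delta>: "0 < \<delta>" "\<delta> < e" "\<delta> < d" "\<delta> < r" using e d(1) assms(5) by (auto simp: \<delta>_def)
  (* \<delta> is less than d, so that s stays in I, and less than r, so that s does not pass beyond 0. *)
  define s where "s = (if \<bar>t\<bar> < r then t else t - \<delta> * sgn t)"
  have "\<bar>s\<bar> < r" "dist s t \<le> \<delta>"
    using \<delta> assms(4,5) by (auto simp: s_def dist_real_def sgn_real_def split: if_splits)
  moreover from this have "s \<in> I" using d(2) \<delta> by (auto simp: dist_commute subset_iff)
  ultimately show "\<exists>s\<in>{s \<in> I. \<exists>r\<in>R. \<bar>s\<bar> < r}. dist s t < e" using \<delta> assms(3) by (intro bexI[of _ s]) auto
qed

text \<open>The intervals of radius \<open>r\<close> are nested around 0, so their union is an interval for any set of radii.\<close>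

lemma open_slopes_convex:
  fixes I R :: "real set"
  assumes "convex I"
  shows "convex {s \<in> I. \<exists>r\<in>R. \<bar>s\<bar> < r}"
proof -
  have "is_interval {s::real. \<exists>r\<in>R. \<bar>s\<bar> < r}"
    unfolding is_interval_1
  proof (intro ballI allI impI, elim conjE)
    fix a b x assume a: "a \<in> {s. \<exists>r\<in>R. \<bar>s\<bar> < r}" and b: "b \<in> {s. \<exists>r\<in>R. \<bar>s\<bar> < r}" and x: "a \<le> x" "x \<le> b"
    obtain r r' where r: "r \<in> R" "\<bar>a\<bar> < r" "r' \<in> R" "\<bar>b\<bar> < r'" using a b by auto
    have "\<bar>x\<bar> < r \<or> \<bar>x\<bar> < r'" using x r by linarith
    then show "x \<in> {s. \<exists>r\<in>R. \<bar>s\<bar> < r}" using r by blast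
  qed
  then have "convex {s::real. \<exists>r\<in>R. \<bar>s\<bar> < r}" by (simp add: is_interval_convex_1)
  moreover have "{s \<in> I. \<exists>r\<in>R. \<bar>s\<bar> < r} = I \<inter> {s. \<exists>r\<in>R. \<bar>s\<bar> < r}" by blast
  ultimately show ?thesis using assms by (simp add: convex_Int)
qed

lemma open_slopes_open:
  fixes I R :: "real set"
  assumes "open I"
  shows "open {s \<in> I. \<exists>r\<in>R. \<bar>s\<bar> < r}"
proof -
  have "{s \<in> I. \<exists>r\<in>R. \<bar>s\<bar> < r} = I \<inter> (\<Union>r\<in>R. {- r<..<r})" by (auto simp: abs_less_iff)
  then show ?thesis using assms by (simp add: open_Int open_UN)
qed

section \<open>The change on the whole manifold\<close>

locale beta_conformal_change = homogeneous_change D f \<psi>1 \<psi>2 \<psi>3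
  for D f \<psi>1 \<psi>2 \<psi>3 +
  fixes X :: "'a topology" and \<A> :: "('a, 'n::finite) chart set"
    and L \<beta> :: "'a \<times> ('a, 'n) tvec \<Rightarrow> real" and \<sigma> :: "'a \<Rightarrow> real"
  assumes dim3: "CARD('n) \<ge> 3"
    and M: "smooth_manifold X \<A>"
    and riem: "riemannian_space X \<A> L"
    and form: "one_form \<A> \<beta>"
    and fin: "finsler_space X \<A> (change_domain X \<A> D \<sigma> L \<beta>) (changed_metric f \<sigma> L \<beta>)"
begin

abbreviation T where "T \<equiv> change_domain X \<A> D \<sigma> L \<beta>"
abbreviation Lbar where "Lbar \<equiv> changed_metric f \<sigma> L \<beta>"
definition W where "W = change_arg \<sigma> L \<beta> ` T"

abbreviation defect :: "real \<Rightarrow> real" where "defect \<equiv> profile_defect \<psi> \<psi>1 \<psi>2 \<psi>3"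

text \<open>The components of \<open>g\<close> at \<open>x\<close>, evaluated at the vector 1, an arbitrary nonzero choice.\<close>

definition gmat :: "('a, 'n) chart \<Rightarrow> real ^ 'n \<Rightarrow> real ^ 'n ^ 'n" where
  "gmat c x = fund_tensor (local_rep \<A> c L x) 1"
definition scale :: "('a, 'n) chart \<Rightarrow> real ^ 'n \<Rightarrow> real" where
  "scale c x = exp (\<sigma> (chart_inv c x))"
definition Amat :: "('a, 'n) chart \<Rightarrow> real ^ 'n \<Rightarrow> real ^ 'n ^ 'n" where
  "Amat c x = (scale c x)\<^sup>2 *\<^sub>R gmat c x"
definition bvec :: "('a, 'n) chart \<Rightarrow> real ^ 'n \<Rightarrow> real ^ 'n" where
  "bvec c x = form_components \<A> c \<beta> x"
text \<open>A chart together with the coordinates of a point of its domain, that is, a tangent space with linear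
  coordinates.\<close>

definition sites :: "(('a, 'n) chart \<times> (real ^ 'n)) set" where
  "sites = {(c, x). c \<in> \<A> \<and> x \<in> snd c ` fst c}"

lemma scale_pos: "0 < scale c x" by (simp add: scale_def)

lemma one_neq_0: "(1 :: real ^ 'n) \<noteq> 0" by (simp add: vec_eq_iff)

context
  fixes c x assumes site: "(c, x) \<in> sites"
begin

lemma L_fibre:
  assumes "y \<noteq> 0"
  shows "0 < local_rep \<A> c L x y" "0 < t \<Longrightarrow> local_rep \<A> c L x (t *\<^sub>R y) = t * local_rep \<A> c L x y"
    "local_rep \<A> c L x differentiable at y" "vpartial i (local_rep \<A> c L x) differentiable at y"
    "fund_tensor (local_rep \<A> c L x) y = gmat c x"
proof -
  let ?S = "slit_tangent_bundle X \<A>"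
  obtain p where c: "c \<in> \<A>" and p: "p \<in> fst c" "x = snd c p" using site by (auto simp: sites_def)
  have fin: "finsler_space X \<A> ?S L" using riem by (simp add: riemannian_space_def)
  have bp: "bundle_point \<A> c x y \<in> ?S" using bundle_point_in_slit[OF M c p(1) assms] p(2) by simp
  then show "0 < local_rep \<A> c L x y"
    using fin by (auto simp: finsler_space_def local_rep_def)
  show "local_rep \<A> c L x (t *\<^sub>R y) = t * local_rep \<A> c L x y" if "0 < t"
  proof -
    obtain q v where qv: "bundle_point \<A> c x y = (q, v)" by fastforce
    have "bundle_point \<A> c x (t *\<^sub>R y) = (q, \<lambda>d. t *\<^sub>R v d)"
      using bundle_point_scaleR[OF M c p(1), of t y] qv p(2) by simp
    moreover have "L (q, \<lambda>d. t *\<^sub>R v d) = t * L (q, v)"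
      using fin bp that unfolding qv finsler_space_def by blast
    ultimately show ?thesis by (simp add: local_rep_def qv)
  qed
  have sm: "smooth_on (coord_set \<A> c ?S) (\<lambda>(x, y). local_rep \<A> c L x y)"
    using fin c by (simp add: finsler_space_def)
  have "(x, z) \<in> coord_set \<A> c ?S" if "z \<in> - {0}" for z
    using that p coord_set_slit[OF M c] by auto
  note sl = slice_differentiable[OF sm this, of "- {0}" y]
  have "open (- {0 :: real ^ 'n})" by (rule open_Compl) simp
  from sl[OF _ this] show "local_rep \<A> c L x differentiable at y" "vpartial i (local_rep \<A> c L x) differentiable at y"
    using assms by simp_all
  show "fund_tensor (local_rep \<A> c L x) y = gmat c x"
    unfolding gmat_def using riem c p assms one_neq_0 unfolding riemannian_space_def by blast
qed

lemma L_sq: "y \<noteq> 0 \<Longrightarrow> (local_rep \<A> c L x y)\<^sup>2 = y \<bullet> (gmat c x *v y)"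
  and gmat_sym: "gmat c x $ i $ j = gmat c x $ j $ i"
proof -
  note r = riemannian_fibre[of "local_rep \<A> c L x" "gmat c x", OF L_fibre]
  show "y \<noteq> 0 \<Longrightarrow> (local_rep \<A> c L x y)\<^sup>2 = y \<bullet> (gmat c x *v y)" by (rule r(1))
  show "gmat c x $ i $ j = gmat c x $ j $ i" by (rule r(2))
qed

lemma Amat_mult: "Amat c x *v y = (scale c x)\<^sup>2 *\<^sub>R (gmat c x *v y)"
  by (simp add: Amat_def scaleR_matrix_vector_assoc)

lemma fibre: "fibre_change (Amat c x) I \<psi> \<psi>1 \<psi>2 \<psi>3"
proof
  show "Amat c x $ i $ j = Amat c x $ j $ i" for i j by (simp add: Amat_def gmat_sym[of i j])
  show "0 < y \<bullet> (Amat c x *v y)" if "y \<noteq> 0" for y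
    using L_sq[OF that] L_fibre(1)[OF that] scale_pos[of c x] by (simp add: Amat_mult flip: L_sq[OF that])
qed (simp_all add: open_I deriv_\<psi>)

interpretation fib: fibre_change "Amat c x" "bvec c x" I \<psi> \<psi>1 \<psi>2 \<psi>3
  by (rule fibre)

lemma nrm_eq: "y \<noteq> 0 \<Longrightarrow> fib.nrm y = scale c x * local_rep \<A> c L x y"
  using L_sq[of y] L_fibre(1)[of y] scale_pos[of c x]
  by (simp add: fib.nrm_def Amat_mult real_sqrt_mult flip: L_sq)

lemma change_arg_eq:
  assumes "y \<noteq> 0"
  shows "change_arg \<sigma> L \<beta> (bundle_point \<A> c x y) = (fib.nrm y, bvec c x \<bullet> y)"
proof -
  have "local_rep \<A> c \<beta> x y = bvec c x \<bullet> y"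
    using form site by (auto simp: one_form_def bvec_def sites_def)
  then show ?thesis
    using nrm_eq[OF assms] by (simp add: change_arg_def local_rep_def scale_def bundle_point_def)
qed

lemma arg_in_D: "y \<noteq> 0 \<Longrightarrow> (fib.nrm y, bvec c x \<bullet> y) \<in> D \<longleftrightarrow> y \<in> fib.U"
  using in_D_iff[OF fib.nrm_pos, of y "bvec c x \<bullet> y"] by (simp add: fib.U_def fib.slope_def)

lemma bundle_point_in_T: "bundle_point \<A> c x y \<in> T \<longleftrightarrow> y \<in> fib.U"
proof -
  have c: "c \<in> \<A>" and x: "x \<in> snd c ` fst c" using site by (auto simp: sites_def)
  have "bundle_point \<A> c x y \<in> slit_tangent_bundle X \<A> \<longleftrightarrow> y \<noteq> 0"
    using coord_set_slit[OF M c] x by (auto simp: coord_set_def set_eq_iff)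
  then show ?thesis
    using arg_in_D[of y] change_arg_eq[of y] by (auto simp: change_domain_def fib.U_def)
qed

lemma coord_set_T: "(x, y) \<in> coord_set \<A> c T \<longleftrightarrow> y \<in> fib.U"
  using bundle_point_in_T site by (auto simp: coord_set_def sites_def)

lemma Lbar_eq: "y \<in> fib.U \<Longrightarrow> local_rep \<A> c Lbar x y = fib.F y"
proof -
  assume y: "y \<in> fib.U"
  then have y0: "y \<noteq> 0" by (simp add: fib.U_def)
  then have "(fib.nrm y, bvec c x \<bullet> y) \<in> D" using arg_in_D y by blast
  from f_eq[OF this] show ?thesis
    by (simp add: local_rep_def changed_metric_def change_arg_eq[OF y0] fib.F_def fib.slope_def)
qed

lemma fund_tensor_invertible: "y \<in> fib.U \<Longrightarrow> invertible (fund_tensor fib.F y)"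
proof -
  assume y: "y \<in> fib.U"
  have "c \<in> \<A>" using site by (simp add: sites_def)
  then have "invertible (fund_tensor (local_rep \<A> c Lbar x) y)"
    using fin y coord_set_T[of y] by (auto simp: finsler_space_def)
  then show ?thesis using fund_tensor_cong[OF fib.open_U y Lbar_eq] by simp
qed

lemma C_reducible_at_iff:
  assumes y: "y \<in> fib.U"
  shows "(\<forall>i j k. let G = local_rep \<A> c Lbar x in
        cartan G y i j k = 1 / (real CARD('n) + 1) *
          (angular G y i j * cartan_trace G y k + angular G y k i * cartan_trace G y j
             + angular G y j k * cartan_trace G y i)) \<longleftrightarrow> fib.mcov y = 0 \<or> defect (fib.slope y) = 0"
  unfolding Let_def fib.C_reducible_fibre_iff[OF dim3 y fund_tensor_invertible[OF y], symmetric]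
  by (simp add: cartan_cong[OF fib.open_U y Lbar_eq] angular_cong[OF fib.open_U y Lbar_eq]
      cartan_trace_cong[OF fib.open_U y Lbar_eq])

lemma m_covec_eq: "y \<noteq> 0 \<Longrightarrow> m_covec (local_rep \<A> c L x) (bvec c x) y = fib.mcov y"
  using L_fibre(1)[of y] scale_pos[of c x]
  by (simp add: m_covec_def lower_y_def L_fibre(5) fib.mcov_def fib.slope_def fib.lcov_def nrm_eq Amat_mult
      power2_eq_square)

lemma m_square_eq: "y \<noteq> 0 \<Longrightarrow> m_square (local_rep \<A> c L x) (bvec c x) y = (scale c x)\<^sup>2 * fib.m_sq y"
proof -
  assume y: "y \<noteq> 0"
  have "invertible (gmat c x)"
  proof -
    have "z = 0" if "gmat c x *v z = 0" for z
    proof -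
      have "Amat c x *v z = 0" using that by (simp add: Amat_mult)
      then show "z = 0" by (metis fib.invertible_A matrix_inv_vector(2) matrix_vector_mult_0_right)
    qed
    then show ?thesis unfolding invertible_left_inverse matrix_left_invertible_ker by blast
  qed
  note inv = matrix_inv_vector[OF this]
  let ?w = "matrix_inv (Amat c x) *v fib.mcov y"
  have "fib.mcov y = gmat c x *v ((scale c x)\<^sup>2 *\<^sub>R ?w)"
    using matrix_inv_vector(1)[OF fib.invertible_A, of "fib.mcov y"]
    by (simp add: Amat_mult matrix_vector_mult_scaleR)
  then have "matrix_inv (gmat c x) *v fib.mcov y = (scale c x)\<^sup>2 *\<^sub>R ?w" using inv(2) by metis
  then show ?thesis
    unfolding m_square_def fund_inverse_def m_covec_eq[OF y] L_fibre(5)[OF y] quadratic_form_sum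
    by (simp add: fib.m_sq_def)
qed

text \<open>At a point with \<open>m \<noteq> 0\<close> the other nonvanishing conditions hold automatically, and
  \<open>p p\<^sub>0\<^sub>2 - 3 q\<^sub>0 p\<^sub>-\<^sub>1\<close> is the defect of the profile times a positive factor.\<close>

lemma alphas_at_iff:
  assumes y: "y \<in> fib.U"
  shows "(let w = change_arg \<sigma> L \<beta> (bundle_point \<A> c x y);
            F = local_rep \<A> c L x;
            b = form_components \<A> c \<beta> x;
            s = \<sigma> (chart_inv c x);
            msq = m_square F b y;
            p = coef_p f (F y) w
        in m_covec F b y \<noteq> 0 \<longrightarrow> msq \<noteq> 0 \<longrightarrow> p \<noteq> 0 \<longrightarrow> exp s * p + msq * coef_q0 f w \<noteq> 0 \<longrightarrow>
           alpha1 CARD('n) f s (F y) msq w = 0 \<and> alpha2 CARD('n) f s (F y) msq w = 0)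
     \<longleftrightarrow> fib.mcov y = 0 \<or> defect (fib.slope y) = 0"
proof -
  have y0: "y \<noteq> 0" using y by (simp add: fib.U_def)
  define t e u N where "t = fib.slope y" and "e = scale c x" and "u = fib.nrm y" and "N = local_rep \<A> c L x y"
  define w where "w = (u, bvec c x \<bullet> y)"
  have w: "change_arg \<sigma> L \<beta> (bundle_point \<A> c x y) = w" using change_arg_eq[OF y0] by (simp add: w_def u_def)
  have D: "(u, bvec c x \<bullet> y) \<in> D" using arg_in_D[OF y0] y by (simp add: u_def)
  have pos: "0 < e" "0 < N" "u = e * N" using scale_pos L_fibre(1)[OF y0] nrm_eq[OF y0] by (simp_all add: e_def N_def u_def)
  have t: "bvec c x \<bullet> y / u = t" by (simp add: t_def u_def fib.slope_def)
  note P = partials[OF D, unfolded t, folded w_def]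
  have fw: "f w = u * \<psi> t" using f_eq[OF D] by (simp add: w_def t)
  have nz: "\<psi> t \<noteq> 0" "fib.chi t \<noteq> 0" using fib.chi_nonzero[OF dim3 y fund_tensor_invertible[OF y]] by (auto simp: t_def)
  have p: "coef_p f N w = e * (\<psi> t * fib.chi t)" using pos by (simp add: coef_p_def fw P fib.chi_def)
  have q0: "coef_q0 f w = \<psi> t * \<psi>2 t" using pos by (simp add: coef_q0_def fw P)
  have pm1: "coef_pm1 f N w = (\<psi>1 t * fib.chi t - t * \<psi> t * \<psi>2 t) / N"
    using pos nz by (simp add: coef_pm1_def p fw P field_simps)
  have p02: "coef_p02 f w = (3 * \<psi>1 t * \<psi>2 t + \<psi> t * \<psi>3 t) / u" by (rule P)
  have es: "exp (\<sigma> (chart_inv c x)) = e" by (simp add: e_def scale_def)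
  define m2 where "m2 = e\<^sup>2 * fib.m_sq y"
  have m2: "m_square (local_rep \<A> c L x) (bvec c x) y = m2" using m_square_eq[OF y0] by (simp add: m2_def e_def)
  have \<Delta>: "e * coef_p f N w + m2 * coef_q0 f w = e\<^sup>2 * (\<psi> t * fib.chi t + fib.m_sq y * (\<psi> t * \<psi>2 t))"
    unfolding p q0 m2_def by (simp add: power2_eq_square algebra_simps)
  have "coef_p f N w * coef_p02 f w - 3 * coef_q0 f w * coef_pm1 f N w = (\<psi> t)\<^sup>2 / N * defect t"
    unfolding p q0 pm1 p02 fib.defect_eq using pos by (simp add: field_simps power2_eq_square)
  then have K: "coef_p f N w * coef_p02 f w = 3 * coef_q0 f w * coef_pm1 f N w \<longleftrightarrow> defect t = 0"
    using pos nz by auto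
  show ?thesis
  proof (cases "fib.mcov y = 0")
    case True
    then show ?thesis using m_covec_eq[OF y0] by (simp add: bvec_def)
  next
    case False
    have m2nz: "m2 \<noteq> 0" using fib.m_sq_pos[OF False] pos by (simp add: m2_def)
    have pnz: "coef_p f N w \<noteq> 0" using p nz pos by simp
    have \<Delta>nz: "exp (\<sigma> (chart_inv c x)) * coef_p f N w + m2 * coef_q0 f w \<noteq> 0"
      unfolding es \<Delta> using fib.m_sq_coefficient_nonzero[OF y fund_tensor_invertible[OF y] _ False] nz pos
      by (simp add: t_def)
    show ?thesis
      unfolding Let_def w N_def[symmetric] bvec_def[symmetric] m_covec_eq[OF y0] m2
      using alphas_zero_iff[OF pnz \<Delta>nz m2nz, of "CARD('n)"] False m2nz pnz \<Delta>nz K by (simp add: t_def)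
  qed
qed

end

text \<open>The length of \<open>b\<close> with respect to \<open>A\<close>, the supremum of the slopes in the tangent space.\<close>

definition radius :: "('a, 'n) chart \<times> (real ^ 'n) \<Rightarrow> real" where
  "radius = (\<lambda>(c, x). sqrt (euclidean_fibre.b_sq (Amat c x) (bvec c x)))"

text \<open>The slopes at which some vector \<open>m\<close> is nonzero (\<open>slope_witness\<close>, \<open>slope_bounds\<close>).\<close>

definition slopes :: "real set" where
  "slopes = {t \<in> I. \<exists>r\<in>radius ` sites. \<bar>t\<bar> < r}"

lemma slope_witness:
  assumes "t \<in> slopes"
  obtains c x y where "(c, x) \<in> sites" "y \<in> fibre_change.U (Amat c x) (bvec c x) I"
    "euclidean_fibre.nrm (Amat c x) y = 1" "euclidean_fibre.slope (Amat c x) (bvec c x) y = t"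
    "euclidean_fibre.mcov (Amat c x) (bvec c x) y \<noteq> 0"
proof -
  obtain c x where s: "(c, x) \<in> sites" and r: "\<bar>t\<bar> < radius (c, x)" and tI: "t \<in> I"
    using assms by (auto simp: slopes_def)
  interpret fib: fibre_change "Amat c x" "bvec c x" I \<psi> \<psi>1 \<psi>2 \<psi>3 by (rule fibre[OF s])
  have r: "\<bar>t\<bar> < sqrt fib.b_sq" using r by (simp add: radius_def)
  obtain y where y: "y \<noteq> 0" "fib.nrm y = 1" "fib.slope y = t" using fib.slope_attained[OF dim3 r] by blast
  show ?thesis
    by (rule that[OF s _ y(2,3)]) (use y tI r fib.slope_range(2)[OF y(1)] in \<open>auto simp: fib.U_def\<close>)
qed

lemma slope_bounds:
  assumes s: "(c, x) \<in> sites" and y: "y \<in> fibre_change.U (Amat c x) (bvec c x) I"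
  defines "t \<equiv> euclidean_fibre.slope (Amat c x) (bvec c x) y"
  shows "t \<in> I" "\<bar>t\<bar> \<le> radius (c, x)" "euclidean_fibre.mcov (Amat c x) (bvec c x) y \<noteq> 0 \<Longrightarrow> t \<in> slopes"
proof -
  interpret fib: fibre_change "Amat c x" "bvec c x" I \<psi> \<psi>1 \<psi>2 \<psi>3 by (rule fibre[OF s])
  have y0: "y \<noteq> 0" and tI: "t \<in> I" using y by (auto simp: fib.U_def t_def)
  show "t \<in> I" by (rule tI)
  show "\<bar>t\<bar> \<le> radius (c, x)" using fib.slope_range(1)[OF y0] by (simp add: radius_def t_def)
  assume "euclidean_fibre.mcov (Amat c x) (bvec c x) y \<noteq> 0"
  then have "\<bar>t\<bar> < radius (c, x)" using fib.slope_range(2)[OF y0] by (simp add: radius_def t_def)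
  then show "t \<in> slopes" using s tI by (auto simp: slopes_def)
qed

text \<open>Both C-reducibility and the vanishing of the coefficients are conditions at each vector of the domain of
  the change, equivalent there to the same alternative; passing to slopes turns the quantification over
  vectors into one over an interval.\<close>

lemma pointwise_iff:
  assumes "\<And>c x y. (c, x) \<in> sites \<Longrightarrow> y \<in> fibre_change.U (Amat c x) (bvec c x) I \<Longrightarrow>
    P c x y \<longleftrightarrow> euclidean_fibre.mcov (Amat c x) (bvec c x) y = 0 \<or>
      defect (euclidean_fibre.slope (Amat c x) (bvec c x) y) = 0"
  shows "(\<forall>c\<in>\<A>. \<forall>(x, y)\<in>coord_set \<A> c T. P c x y) \<longleftrightarrow> (\<forall>t\<in>slopes. defect t = 0)"
proof (intro iffI ballI)
  fix t assume P: "\<forall>c\<in>\<A>. \<forall>(x, y)\<in>coord_set \<A> c T. P c x y" and t: "t \<in> slopes"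
  obtain c x y where *: "(c, x) \<in> sites" "y \<in> fibre_change.U (Amat c x) (bvec c x) I"
    "euclidean_fibre.slope (Amat c x) (bvec c x) y = t" "euclidean_fibre.mcov (Amat c x) (bvec c x) y \<noteq> 0"
    using slope_witness[OF t] by metis
  have "P c x y" using P coord_set_T[OF *(1), of y] * by (auto simp: sites_def)
  then show "defect t = 0" using assms[OF *(1,2)] * by simp
next
  fix c z assume K: "\<forall>t\<in>slopes. defect t = 0" and c: "c \<in> \<A>" and z: "z \<in> coord_set \<A> c T"
  obtain x y where xy: "z = (x, y)" by fastforce
  have s: "(c, x) \<in> sites" using c z xy by (simp add: sites_def coord_set_def)
  have y: "y \<in> fibre_change.U (Amat c x) (bvec c x) I" using coord_set_T[OF s, of y] z xy by simp
  have "P c x y" using assms[OF s y] slope_bounds(3)[OF s y] K by blast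
  then show "case z of (x, y) \<Rightarrow> P c x y" by (simp add: xy)
qed

lemma C_reducible_iff: "C_reducible \<A> T Lbar \<longleftrightarrow> (\<forall>t\<in>slopes. defect t = 0)"
  unfolding C_reducible_def
  by (rule pointwise_iff) (simp only: C_reducible_at_iff)

lemma alphas_vanish_iff: "alphas_vanish \<A> T f \<sigma> L \<beta> \<longleftrightarrow> (\<forall>t\<in>slopes. defect t = 0)"
  unfolding alphas_vanish_def
  by (rule pointwise_iff) (simp only: alphas_at_iff)

text \<open>On these slopes the restriction of \<open>f\<close> to the attained values determines the profile on an open set, so
  an explicit formula for \<open>f\<close> there may be differentiated.\<close>

lemma W_slopes: "t \<in> slopes \<Longrightarrow> (1, t) \<in> W"
proof -
  assume t: "t \<in> slopes"
  obtain c x y where *: "(c, x) \<in> sites" "y \<in> fibre_change.U (Amat c x) (bvec c x) I"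
    "euclidean_fibre.nrm (Amat c x) y = 1" "euclidean_fibre.slope (Amat c x) (bvec c x) y = t"
    using slope_witness[OF t] by metis
  interpret fib: fibre_change "Amat c x" "bvec c x" I \<psi> \<psi>1 \<psi>2 \<psi>3 by (rule fibre[OF *(1)])
  have "y \<noteq> 0" using *(2) by (simp add: fib.U_def)
  from change_arg_eq[OF *(1) this] have "change_arg \<sigma> L \<beta> (bundle_point \<A> c x y) = (1, t)"
    using *(3,4) by (simp add: fib.slope_def)
  moreover have "bundle_point \<A> c x y \<in> T" using bundle_point_in_T[OF *(1)] *(2) by blast
  ultimately show ?thesis unfolding W_def by (metis image_eqI)
qed

lemma W_D:
  assumes "(u, v) \<in> W"
  obtains s where "(u, v) \<in> D" "0 < u" "s \<in> sites" "\<bar>v / u\<bar> \<le> radius s" "v / u \<in> I"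
proof -
  obtain w where w: "w \<in> T" "change_arg \<sigma> L \<beta> w = (u, v)" using assms unfolding W_def by (metis imageE)
  then have "w \<in> slit_tangent_bundle X \<A>" and D: "(u, v) \<in> D" by (auto simp: change_domain_def)
  from slit_point_eq_bundle_point[OF M this(1)] obtain c p y where
    c: "c \<in> \<A>" "p \<in> fst c" "y \<noteq> 0" "w = bundle_point \<A> c (snd c p) y" by metis
  define x where "x = snd c p"
  have s: "(c, x) \<in> sites" using c by (auto simp: sites_def x_def)
  interpret fib: fibre_change "Amat c x" "bvec c x" I \<psi> \<psi>1 \<psi>2 \<psi>3 by (rule fibre[OF s])
  have y: "y \<in> fib.U" using bundle_point_in_T[OF s] w(1) c(4) by (simp add: x_def)
  have "v / u = fib.slope y"
    using change_arg_eq[OF s c(3)] w(2) unfolding c(4) x_def[symmetric] by (simp add: fib.slope_def)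
  then show ?thesis
    using that[OF D first_pos[OF D] s] slope_bounds[OF s y] by simp
qed

lemma chi_nonzero_on_slopes: "t \<in> slopes \<Longrightarrow> \<psi> t - t * \<psi>1 t \<noteq> 0"
proof -
  assume t: "t \<in> slopes"
  obtain c x y where *: "(c, x) \<in> sites" "y \<in> fibre_change.U (Amat c x) (bvec c x) I"
    "euclidean_fibre.slope (Amat c x) (bvec c x) y = t"
    using slope_witness[OF t] by metis
  interpret fib: fibre_change "Amat c x" "bvec c x" I \<psi> \<psi>1 \<psi>2 \<psi>3 by (rule fibre[OF *(1)])
  show ?thesis
    using fib.chi_nonzero[OF dim3 *(2) fund_tensor_invertible[OF *(1,2)]] *(3) by (simp add: fib.chi_def)
qed

lemma slopes_I: "t \<in> slopes \<Longrightarrow> t \<in> I" by (simp add: slopes_def)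

lemma defect_zero_if_type:
  assumes "randers_type W f \<or> kropina_type W f" "t \<in> slopes"
  shows "defect t = 0"
  unfolding profile_defect_def
proof (rule ode_if_randers_or_kropina[of slopes])
  show "open slopes" unfolding slopes_def by (rule open_slopes_open[OF open_I])
  have W: "(1, t) \<in> W" if "t \<in> slopes" for t using W_slopes[OF that] .
  have linear: "(\<exists>c1 c2. \<forall>t\<in>slopes. \<psi> t = c2 + c1 * t)" if "\<forall>(u, v)\<in>W. f (u, v) = c2 * u + c1 * v" for c1 c2
    using bspec[OF that W] by (intro exI[of _ c1] exI[of _ c2]) (simp add: \<psi>_def)
  have root: "(\<exists>a k c d. c \<noteq> 0 \<and> (\<forall>t\<in>slopes. 0 \<le> k * t\<^sup>2 + c \<and> \<psi> t = a * sqrt (k * t\<^sup>2 + c) + d * t))"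
    if "c4 \<noteq> 0" "\<forall>(u, v)\<in>W. 0 \<le> c3 * v\<^sup>2 + c4 * u\<^sup>2 \<and> f (u, v) = c0 * sqrt (c3 * v\<^sup>2 + c4 * u\<^sup>2) + c5 * v" for c0 c3 c4 c5
    using that(1) bspec[OF that(2) W]
    by (intro exI[of _ c0] exI[of _ c3] exI[of _ c4] exI[of _ c5]) (simp add: \<psi>_def)
  have quot: "\<exists>a d. \<forall>t\<in>slopes. t \<noteq> 0 \<and> \<psi> t = a / t + d * t"
    if "\<forall>(u, v)\<in>W. v \<noteq> 0 \<and> f (u, v) = c6 * u\<^sup>2 / v + c7 * v" for c6 c7
    using bspec[OF that W] by (intro exI[of _ c6] exI[of _ c7]) (simp add: \<psi>_def)
  show "(\<exists>c1 c2. \<forall>t\<in>slopes. \<psi> t = c2 + c1 * t) \<or>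
    (\<exists>a k c d. c \<noteq> 0 \<and> (\<forall>t\<in>slopes. 0 \<le> k * t\<^sup>2 + c \<and> \<psi> t = a * sqrt (k * t\<^sup>2 + c) + d * t)) \<or>
    (\<exists>a d. \<forall>t\<in>slopes. t \<noteq> 0 \<and> \<psi> t = a / t + d * t)"
    using assms(1) unfolding randers_type_def kropina_type_def
  proof (elim disjE exE conjE)
    fix c1 c2 assume "\<forall>(u, v)\<in>W. f (u, v) = c2 * u + c1 * v"
    from linear[OF this] show ?thesis by (rule disjI1)
  next
    fix c0 c3 c4 c5 :: real assume "c4 \<noteq> 0" "\<forall>(u, v)\<in>W. 0 \<le> c3 * v\<^sup>2 + c4 * u\<^sup>2 \<and> f (u, v) = c0 * sqrt (c3 * v\<^sup>2 + c4 * u\<^sup>2) + c5 * v"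
    from root[OF this] show ?thesis by (rule disjI2[OF disjI1])
  next
    fix c6 c7 assume "\<forall>(u, v)\<in>W. v \<noteq> 0 \<and> f (u, v) = c6 * u\<^sup>2 / v + c7 * v"
    from quot[OF this] show ?thesis by (rule disjI2[OF disjI2])
  qed
qed (use assms(2) slopes_I deriv_\<psi> in auto)

text \<open>If \<open>slopes\<close> is empty, no slope other than 0 is attained. Otherwise the solution on the interval \<open>slopes\<close>
  extends to all attained slopes by continuity. In the Kropina case one also needs that 0 is not attained:
  if it is, then it belongs to \<open>slopes\<close>, where the solution excludes it.\<close>

lemma type_if_defect_zero:
  assumes "\<forall>t\<in>slopes. defect t = 0"
  shows "randers_type W f \<or> kropina_type W f"
proof (cases "slopes = {}")
  case True
  have "v = 0 \<and> f (u, v) = \<psi> 0 * u" if uv: "(u, v) \<in> W" for u v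
  proof -
    obtain s where s: "(u, v) \<in> D" "0 < u" "s \<in> sites" "\<bar>v / u\<bar> \<le> radius s" "v / u \<in> I"
      using W_D[OF uv] by blast
    have "\<not> 0 < radius s"
      using closed_radius_in_closure[OF open_I s(5) imageI[OF s(3), of radius] s(4), folded slopes_def] True by auto
    then have "v / u = 0" using s(4) by linarith
    then show ?thesis using f_eq[OF s(1)] s(2) by simp
  qed
  (* The 1-form vanishes wherever the change is defined, and only \<psi> 0 matters. *)
  then have "\<forall>(u, v)\<in>W. f (u, v) = \<psi> 0 * u + 0 * v" by auto
  then show ?thesis unfolding randers_type_def by blast
next
  case False
  have W: "u > 0 \<and> v / u \<in> closure slopes \<and> v / u \<in> I \<and> (v = 0 \<longrightarrow> 0 \<in> slopes) \<and> f (u, v) = u * \<psi> (v / u)"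
    if uv: "(u, v) \<in> W" for u v
  proof -
    obtain s where s: "(u, v) \<in> D" "0 < u" "s \<in> sites" "\<bar>v / u\<bar> \<le> radius s" "v / u \<in> I"
      using W_D[OF uv] by blast
    obtain t' r' where r': "r' \<in> radius ` sites" "\<bar>t'\<bar> < r'" using False by (auto simp: slopes_def)
    (* A radius that exceeds the absolute value of some slope is positive, so it admits the slope 0. *)
    have 0: "0 \<in> slopes" if "0 \<in> I" using r' that unfolding slopes_def by force
    have "v / u \<in> closure slopes"
    proof (cases "0 < radius s")
      case True
      then show ?thesis
        using closed_radius_in_closure[OF open_I s(5) imageI[OF s(3), of radius] s(4)] by (simp add: slopes_def)
    next
      case False
      then have "v / u = 0" using s(4) by linarith
      then show ?thesis using 0 s(5) closure_subset[of slopes] by auto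
    qed
    moreover have "v = 0 \<longrightarrow> 0 \<in> slopes" using 0 s(5) by auto
    ultimately show ?thesis using s f_eq[OF s(1)] by blast
  qed
  have cont: "isCont \<psi> t" if "t \<in> I" for t using deriv_\<psi>(1)[OF that] by (rule DERIV_isCont)
  have "(\<exists>a k c d. a \<noteq> 0 \<and> c \<noteq> 0 \<and> (\<forall>t\<in>slopes. 0 < k * t\<^sup>2 + c \<and> \<psi> t = a * sqrt (k * t\<^sup>2 + c) + d * t)) \<or>
         (\<exists>a d. a \<noteq> 0 \<and> (\<forall>t\<in>slopes. t \<noteq> 0 \<and> \<psi> t = a / t + d * t))"
  proof (rule randers_or_kropina_if_ode)
    show "convex slopes" unfolding slopes_def by (rule open_slopes_convex[OF convex_I])
  qed (use slopes_I deriv_\<psi> chi_nonzero_on_slopes assms in \<open>auto simp: profile_defect_def\<close>)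
  then show ?thesis
  proof (elim disjE exE conjE)
    fix a k c d :: real
    assume nz: "a \<noteq> 0" "c \<noteq> 0" and *: "\<forall>t\<in>slopes. 0 < k * t\<^sup>2 + c \<and> \<psi> t = a * sqrt (k * t\<^sup>2 + c) + d * t"
    have "0 \<le> k * v\<^sup>2 + c * u\<^sup>2 \<and> f (u, v) = a * sqrt (k * v\<^sup>2 + c * u\<^sup>2) + d * v" if uv: "(u, v) \<in> W" for u v
    proof -
      define t where "t = v / u"
      have w: "u > 0" "t \<in> closure slopes" "t \<in> I" "f (u, v) = u * \<psi> t" using W[OF uv] by (auto simp: t_def)
      have e: "k * v\<^sup>2 + c * u\<^sup>2 = u\<^sup>2 * (k * t\<^sup>2 + c)"
        using w(1) by (simp add: t_def field_simps power2_eq_square)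
      have "0 \<le> k * t\<^sup>2 + c"
        by (rule closure_nonneg[OF w(2)]) (use * in \<open>auto intro!: continuous_intros less_imp_le\<close>)
      moreover have \<psi>t: "\<psi> t = a * sqrt (k * t\<^sup>2 + c) + d * t"
        by (rule closure_eq[OF w(2) cont[OF w(3)]]) (use * in \<open>auto intro!: continuous_intros\<close>)
      moreover have "sqrt (u\<^sup>2 * (k * t\<^sup>2 + c)) = u * sqrt (k * t\<^sup>2 + c)"
        using w(1) by (simp add: real_sqrt_mult)
      moreover have "f (u, v) = a * (u * sqrt (k * t\<^sup>2 + c)) + d * (u * t)"
        unfolding w(4) \<psi>t by (simp only: distrib_left mult.left_commute)
      moreover have "u * t = v" using w(1) by (simp add: t_def)
      ultimately show ?thesis unfolding e by simp
    qed
    then have "randers_type W f"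
      unfolding randers_type_def using nz
      by (intro disjI2 exI[of _ a] exI[of _ k] exI[of _ c] exI[of _ d]) auto
    then show ?thesis ..
  next
    fix a d :: real
    assume nz: "a \<noteq> 0" and *: "\<forall>t\<in>slopes. t \<noteq> 0 \<and> \<psi> t = a / t + d * t"
    have "v \<noteq> 0 \<and> f (u, v) = a * u\<^sup>2 / v + d * v" if uv: "(u, v) \<in> W" for u v
    proof -
      define t where "t = v / u"
      have w: "u > 0" "t \<in> closure slopes" "t \<in> I" "f (u, v) = u * \<psi> t" using W[OF uv] by (auto simp: t_def)
      have v: "v \<noteq> 0" using W[OF uv] * by blast
      then have t: "t \<noteq> 0" using w(1) by (simp add: t_def)
      have "\<psi> t = a / t + d * t"
        by (rule closure_eq[OF w(2) cont[OF w(3)]]) (use * t in \<open>auto intro!: continuous_intros\<close>)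
      then have "f (u, v) = u * (a / t) + d * (u * t)" by (simp add: w(4) algebra_simps)
      then show ?thesis using w(1) v by (simp add: t_def power2_eq_square)
    qed
    then have "kropina_type W f"
      unfolding kropina_type_def using nz by (intro exI[of _ a] exI[of _ d]) auto
    then show ?thesis ..
  qed
qed

end

theorem theorem2p14:
  fixes X :: "'a topology" and \<A> :: "('a, 'n::finite) chart set"
    and L \<beta> :: "'a \<times> ('a, 'n) tvec \<Rightarrow> real" and \<sigma> :: "'a \<Rightarrow> real"
    and f :: "real \<times> real \<Rightarrow> real" and D :: "(real \<times> real) set"
    and T :: "('a \<times> ('a, 'n) tvec) set" and Lbar :: "'a \<times> ('a, 'n) tvec \<Rightarrow> real"
    and W :: "(real \<times> real) set"
  assumes "T = change_domain X \<A> D \<sigma> L \<beta>"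
    and "Lbar = changed_metric f \<sigma> L \<beta>"
    and "W = change_arg \<sigma> L \<beta> ` T"
    and "CARD('n) \<ge> 3"
    and "smooth_manifold X \<A>"
    and "riemannian_space X \<A> L"
    and "smooth_scalar \<A> \<sigma>"
    and "one_form \<A> \<beta>"
    and "change_function D f"
    and "finsler_space X \<A> T Lbar"
  shows "(alphas_vanish \<A> T f \<sigma> L \<beta> \<longleftrightarrow> C_reducible \<A> T Lbar) \<and>
         (C_reducible \<A> T Lbar \<longleftrightarrow> randers_type W f \<or> kropina_type W f)"
proof -
  have "smooth_on D f" using assms(9) by (simp add: change_function_def)
  from homogeneous_profile_derivs[OF this] obtain p1 p2 p3 where p:
    "\<And>t. (1, t) \<in> D \<Longrightarrow> ((\<lambda>t. f (1, t)) has_real_derivative p1 t) (at t)"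
    "\<And>t. (1, t) \<in> D \<Longrightarrow> (p1 has_real_derivative p2 t) (at t)"
    "\<And>t. (1, t) \<in> D \<Longrightarrow> (p2 has_real_derivative p3 t) (at t)" by blast
  interpret beta_conformal_change D f p1 p2 p3 X \<A> L \<beta> \<sigma>
    by unfold_locales (use assms p in simp_all)
  show ?thesis
    unfolding assms(1-3) alphas_vanish_iff C_reducible_iff using defect_zero_if_type type_if_defect_zero unfolding W_def by blast
qed

end
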